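(* Suppose that the integral $0$-dimensional cohomology class $1\in H^0(\Gamma,\mathbb{Z})=\mathbb{Z}$ is proper Lipschitz. Then, for all $k$, all cohomology classes in $H^k(\Gamma,\mathbb{Z})$ are proper Lipschitz.
   Context: $\Gamma$ is a discrete group with a finite classifying CW complex $B\Gamma$, equipped with the (left-invariant) word metric of a finite generating set. Proper Lipschitz data. $P$ is a finite-dimensional connected locally finite simplicial complex with a free simplicial $\Gamma$-action, and $\alpha:\Gamma\times P\to\mathbb{R}^n$ is a (continuous) map such that: (1) $\alpha$ is invariant under the diagonal $\Gamma$-action on $\Gamma\times P$; (2) $\alpha|_{\gamma\times P}$ is proper for each $\gamma\in\Gamma$; (3) $\alpha|_{\Gamma\times p}$ is 1-Lipschitz for each $p\in P$ with respect to the word metric on $\Gamma$. Let $\Delta^\infty(\Gamma)$ be the infinite simplex spanned by $\Gamma$, $C_*$ its simplicial chain complex (a free resolution of $\mathbb{Z}$ over $\mathbb{Z}\Gamma$), and extend $\alpha$ to $\bar\alpha:\Delta^\infty(\Gamma)\times P\to\mathbb{R}^n$ by $\bar\alpha(\sum t_i\gamma_i,x)=\sum t_i\alpha(\gamma_i,x)$ (barycentric coordinates). Chains. For a $\mathbb{Z}\Gamma$-module $L$ (here $L=\mathbb{Z}$ with trivial action), let $S_m$ be the set of (oriented) $m$-simplices of $P$ and let $D_m^\Gamma(L)$ be the group of $\Gamma$-invariant, possibly infinite, chains $\sum_{\sigma\in S_m}\lambda_\sigma\sigma$ with $\lambda_\sigma\in L$ and $\lambda_{\gamma\sigma}=\gamma\lambda_\sigma$.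 With the simplicial boundary this is a chain complex whose homology is denoted $H_*(P:\Gamma;L)$. The map $\alpha_\cap$. Let $\omega$ be a singular cocycle on $\mathbb{R}^n$ supported in some ball whose class generates $H^n_c(\mathbb{R}^n;\mathbb{Z})=\mathbb{Z}$. For a $k$-simplex $\Delta=[\gamma_0,\dots,\gamma_k]$ of $\Delta^\infty(\Gamma)$ and $\sigma\in S_{n-k}$ put $\phi(\Delta\otimes\sigma)=\omega(\bar\alpha|_{\Delta\times\sigma})$, where $\bar\alpha|_{\Delta\times\sigma}$ is viewed as a singular $n$-chain via the staircase triangulation of the product of the two oriented simplices. For a cycle $z=\sum_\sigma\lambda_\sigma\sigma\in D^\Gamma_{n-k}(L)$, the cochain $(\bar\phi/z)(\Delta)=\sum_{\sigma\in S_{n-k}}\phi(\Delta\otimes\sigma)\lambda_\sigma$ (a finite sum for each $\Delta$) is a $\Gamma$-equivariant cocycle $C_k\to L$, and $\alpha_\cap:H_{n-k}(P:\Gamma;L)\to H^k(\Gamma,L)$ is defined by $\alpha_\cap([z])=[\bar\phi/z]$. (The same construction may be carried out with cellular chain complexes when $E\Gamma$ and $P$ carry $\Gamma$-equivariant CW structures.) A class in $H^*(\Gamma,L)$ is called proper Lipschitz if it lies in the image of $\alpha_\cap$ for some $n$, some finite-dimensional connected locally finite simplicial complex $P$ with a free simplicial $\Gamma$-action, and some (continuous) map $\alpha:\Gamma\times P\to\mathbb{R}^n$ that is invariant under the diagonal $\Gamma$-action, proper on $\gamma\times P$ for each $\gamma\in\Gamma$, and 1-Lipschitz on $\Gamma\times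 p$ for each $p\in P$. *)

theory Defs
  imports "HOL-Homology.Homology" "HOL-Algebra.Group_Action" "HOL-Algebra.Generated_Groups"
    "HOL-Algebra.Product_Groups"
begin

section \<open>The group: word metric and classifying space\<close>

definition word_length :: "('g, 'a) monoid_scheme \<Rightarrow> 'g set \<Rightarrow> 'g \<Rightarrow> nat" where
  "word_length G S g =
     (LEAST l. \<exists>ws. length ws = l \<and> set ws \<subseteq> S \<union> m_inv G ` S \<and> foldr (\<otimes>\<^bsub>G\<^esub>) ws \<one>\<^bsub>G\<^esub> = g)"

definition word_dist :: "('g, 'a) monoid_scheme \<Rightarrow> 'g set \<Rightarrow> 'g \<Rightarrow> 'g \<Rightarrow> nat" where
  "word_dist G S g h = word_length G S (inv\<^bsub>G\<^esub> g \<otimes>\<^bsub>G\<^esub> h)"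

definition Rn_dist :: "nat \<Rightarrow> (nat \<Rightarrow> real) \<Rightarrow> (nat \<Rightarrow> real) \<Rightarrow> real" where
  "Rn_dist n x y = L2_set (\<lambda>i. x i - y i) {..<n}"

definition closed_disc :: "nat \<Rightarrow> (nat \<Rightarrow> real) topology" where
  "closed_disc d = subtopology (Euclidean_space d) {x. Rn_dist d x (\<lambda>i. 0) \<le> 1}"

definition open_disc :: "nat \<Rightarrow> (nat \<Rightarrow> real) topology" where
  "open_disc d = subtopology (Euclidean_space d) {x. Rn_dist d x (\<lambda>i. 0) < 1}"

definition bounding_sphere :: "nat \<Rightarrow> (nat \<Rightarrow> real) topology" where
  "bounding_sphere d = subtopology (Euclidean_space d) {x. Rn_dist d x (\<lambda>i. 0) = 1}"

text \<open>A finite CW structure is a finite set of pairs (dimension, characteristic map).  With only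
  finitely many cells, closure finiteness and the weak topology are automatic.\<close>

definition finite_CW_complex :: "'b topology \<Rightarrow> bool" where
  "finite_CW_complex X \<longleftrightarrow> Hausdorff_space X \<and>
     (\<exists>I :: (nat \<times> ((nat \<Rightarrow> real) \<Rightarrow> 'b)) set. finite I \<and>
        (\<forall>(d, \<Phi>)\<in>I. continuous_map (closed_disc d) X \<Phi> \<and> embedding_map (open_disc d) X \<Phi> \<and>
           \<Phi> ` topspace (bounding_sphere d) \<subseteq>
             (\<Union>(e, \<Psi>)\<in>{(e, \<Psi>)\<in>I. e < d}. \<Psi> ` topspace (open_disc e))) \<and>
        pairwise (\<lambda>(d, \<Phi>) (e, \<Psi>).
           disjnt (\<Phi> ` topspace (open_disc d)) (\<Psi> ` topspace (open_disc e))) I \<and>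
        (\<Union>(d, \<Phi>)\<in>I. \<Phi> ` topspace (open_disc d)) = topspace X)"

text \<open>\<open>B\<close> is a classifying space of the discrete group \<open>G\<close>: it is the base of a principal
  \<open>G\<close>-covering with contractible total space \<open>E\<close>.\<close>

definition classifying_space ::
    "('g, 'a) monoid_scheme \<Rightarrow> 'e topology \<Rightarrow> 'b topology \<Rightarrow> bool" where
  "classifying_space G E B \<longleftrightarrow> topspace E \<noteq> {} \<and> contractible_space E \<and>
     (\<exists>\<psi> q. group_action G (topspace E) \<psi> \<and>
        (\<forall>g\<in>carrier G. continuous_map E E (\<psi> g)) \<and>
        (\<forall>x\<in>topspace E. \<exists>U. openin E U \<and> x \<in> U \<and>
           (\<forall>g\<in>carrier G. g \<noteq> \<one>\<^bsub>G\<^esub> \<longrightarrow> disjnt U (\<psi> g ` U))) \<and>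
        quotient_map E B q \<and>
        (\<forall>x\<in>topspace E. \<forall>y\<in>topspace E. q x = q y \<longleftrightarrow> (\<exists>g\<in>carrier G. y = \<psi> g x)))"


section \<open>Simplicial complexes with a group action\<close>

text \<open>The complexes of interest are connected and locally finite, hence have countably many
  vertices; so nothing is lost by taking all vertices to be natural numbers.\<close>

definition simplicial_complex :: "nat set set \<Rightarrow> bool" where
  "simplicial_complex K \<longleftrightarrow>
     (\<forall>s\<in>K. finite s \<and> s \<noteq> {}) \<and> (\<forall>s\<in>K. \<forall>t. t \<subseteq> s \<and> t \<noteq> {} \<longrightarrow> t \<in> K)"

definition finite_dimensional :: "nat set set \<Rightarrow> bool" where
  "finite_dimensional K \<longleftrightarrow> (\<exists>d. \<forall>s\<in>K. card s \<le> Suc d)"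

definition locally_finite_complex :: "nat set set \<Rightarrow> bool" where
  "locally_finite_complex K \<longleftrightarrow> (\<forall>v\<in>\<Union>K. finite {s\<in>K. v \<in> s})"

text \<open>Points are given by their barycentric coordinates.\<close>

definition closed_simplex :: "nat set \<Rightarrow> (nat \<Rightarrow> real) set" where
  "closed_simplex s = {x. (\<forall>v. 0 \<le> x v) \<and> (\<forall>v. v \<notin> s \<longrightarrow> x v = 0) \<and> (\<Sum>v\<in>s. x v) = 1}"

text \<open>The geometric realization, with the weak topology.\<close>

definition realization :: "nat set set \<Rightarrow> (nat \<Rightarrow> real) topology" where
  "realization K = topology (\<lambda>U. U \<subseteq> (\<Union>s\<in>K. closed_simplex s) \<and>
     (\<forall>s\<in>K. openin (subtopology (powertop_real UNIV) (closed_simplex s)) (U \<inter> closed_simplex s)))"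

lemma openin_realization:
  "openin (realization K) U \<longleftrightarrow> U \<subseteq> (\<Union>s\<in>K. closed_simplex s) \<and>
     (\<forall>s\<in>K. openin (subtopology (powertop_real UNIV) (closed_simplex s)) (U \<inter> closed_simplex s))"
proof -
  let ?L = "\<lambda>U. U \<subseteq> (\<Union>s\<in>K. closed_simplex s) \<and>
     (\<forall>s\<in>K. openin (subtopology (powertop_real UNIV) (closed_simplex s)) (U \<inter> closed_simplex s))"
  have "istopology ?L"
    unfolding istopology_def
  proof (intro conjI allI impI)
    fix S T assume S: "?L S" and T: "?L T"
    show "S \<inter> T \<subseteq> (\<Union>s\<in>K. closed_simplex s)"
      using S by blast
    show "\<forall>s\<in>K. openin (subtopology (powertop_real UNIV) (closed_simplex s))
            (S \<inter> T \<inter> closed_simplex s)"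
    proof
      fix s assume s: "s \<in> K"
      have "openin (subtopology (powertop_real UNIV) (closed_simplex s))
              ((S \<inter> closed_simplex s) \<inter> (T \<inter> closed_simplex s))"
        by (rule openin_Int) (use S T s in blast)+
      then show "openin (subtopology (powertop_real UNIV) (closed_simplex s))
              (S \<inter> T \<inter> closed_simplex s)"
        by (simp only: Int_assoc Int_left_commute Int_absorb)
    qed
  next
    fix \<K> assume *: "\<forall>U\<in>\<K>. ?L U"
    show "\<Union>\<K> \<subseteq> (\<Union>s\<in>K. closed_simplex s)"
      using * by blast
    show "\<forall>s\<in>K. openin (subtopology (powertop_real UNIV) (closed_simplex s))
            (\<Union>\<K> \<inter> closed_simplex s)"
    proof
      fix s assume s: "s \<in> K"
      have "openin (subtopology (powertop_real UNIV) (closed_simplex s))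
              (\<Union>((\<lambda>U. U \<inter> closed_simplex s) ` \<K>))"
      proof (rule openin_Union)
        fix T assume "T \<in> (\<lambda>U. U \<inter> closed_simplex s) ` \<K>"
        then obtain U where "U \<in> \<K>" "T = U \<inter> closed_simplex s" by blast
        with * s show "openin (subtopology (powertop_real UNIV) (closed_simplex s)) T" by blast
      qed
      then show "openin (subtopology (powertop_real UNIV) (closed_simplex s))
              (\<Union>\<K> \<inter> closed_simplex s)"
        by (simp only: Int_Union2)
    qed
  qed
  then show ?thesis
    by (simp only: realization_def topology_inverse')
qed

definition realization_act ::
    "('g, 'a) monoid_scheme \<Rightarrow> nat set set \<Rightarrow> ('g \<Rightarrow> nat \<Rightarrow> nat) \<Rightarrow> 'g \<Rightarrow> (nat \<Rightarrow> real) \<Rightarrow> nat \<Rightarrow> real"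
  where
  "realization_act G K \<psi> g x = (\<lambda>v. if v \<in> \<Union>K then x (\<psi> (inv\<^bsub>G\<^esub> g) v) else 0)"

definition free_simplicial_action ::
    "('g, 'a) monoid_scheme \<Rightarrow> nat set set \<Rightarrow> ('g \<Rightarrow> nat \<Rightarrow> nat) \<Rightarrow> bool" where
  "free_simplicial_action G K \<psi> \<longleftrightarrow> group_action G (\<Union>K) \<psi> \<and>
     (\<forall>g\<in>carrier G. \<forall>s\<in>K. \<psi> g ` s \<in> K) \<and>
     (\<forall>g\<in>carrier G. \<forall>x\<in>topspace (realization K). realization_act G K \<psi> g x = x \<longrightarrow> g = \<one>\<^bsub>G\<^esub>)"


section \<open>Proper Lipschitz data\<close>

definition proper_lipschitz_data ::
    "('g, 'a) monoid_scheme \<Rightarrow> 'g set \<Rightarrow> nat \<Rightarrow> nat set set \<Rightarrow> ('g \<Rightarrow> nat \<Rightarrow> nat) \<Rightarrow>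
     ('g \<Rightarrow> (nat \<Rightarrow> real) \<Rightarrow> (nat \<Rightarrow> real)) \<Rightarrow> bool" where
  "proper_lipschitz_data G S n K \<psi> \<alpha> \<longleftrightarrow>
     simplicial_complex K \<and> K \<noteq> {} \<and> finite_dimensional K \<and> connected_space (realization K) \<and>
     locally_finite_complex K \<and> free_simplicial_action G K \<psi> \<and>
     continuous_map (prod_topology (discrete_topology (carrier G)) (realization K))
       (Euclidean_space n) (\<lambda>(g, x). \<alpha> g x) \<and>
     (\<forall>g\<in>carrier G. \<forall>h\<in>carrier G. \<forall>x\<in>topspace (realization K).
        \<alpha> (g \<otimes>\<^bsub>G\<^esub> h) (realization_act G K \<psi> g x) = \<alpha> h x) \<and>
     (\<forall>g\<in>carrier G. proper_map (realization K) (Euclidean_space n) (\<alpha> g)) \<and>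
     (\<forall>x\<in>topspace (realization K). \<forall>g\<in>carrier G. \<forall>h\<in>carrier G.
        Rn_dist n (\<alpha> g x) (\<alpha> h x) \<le> real (word_dist G S g h))"


section \<open>Invariant chains and cochains\<close>

text \<open>The singular chain carried by a product of simplices depends on the order of the vertices, not
  only on the orientations, so ordered simplices are used throughout: an ordered
  \<open>m\<close>-simplex is a list of \<open>m + 1\<close> vertices, repetitions allowed, spanning a simplex.  The
  ordered and the oriented chain complexes have canonically isomorphic homology, and the ordered
  simplices of the infinite simplex on \<open>G\<close> form the homogeneous bar resolution.\<close>

definition omit :: "nat \<Rightarrow> 'v list \<Rightarrow> 'v list" where
  "omit i xs = take i xs @ drop (Suc i) xs"

definition invariant_functions ::
    "('g, 'a) monoid_scheme \<Rightarrow> 'x set \<Rightarrow> ('g \<Rightarrow> 'x \<Rightarrow> 'x) \<Rightarrow> ('x \<Rightarrow> int) monoid" where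
  "invariant_functions G A \<psi> = (product_group A (\<lambda>_. integer_group))
     \<lparr>carrier := {f \<in> A \<rightarrow>\<^sub>E UNIV. \<forall>g\<in>carrier G. \<forall>x\<in>A. f (\<psi> g x) = f x}\<rparr>"

text \<open>Degrees of chains are integers, so that \<open>n - k\<close> may be negative; there are no simplices of
  negative dimension.\<close>

definition ordered_simplices :: "nat set set \<Rightarrow> int \<Rightarrow> nat list set" where
  "ordered_simplices K m = {\<sigma>. int (length \<sigma>) = m + 1 \<and> set \<sigma> \<in> K}"

text \<open>The chain \<open>\<Sum>\<^sub>\<sigma> \<lambda>\<^sub>\<sigma> \<sigma>\<close>, possibly infinite, is the function \<open>\<sigma> \<mapsto> \<lambda>\<^sub>\<sigma>\<close>.\<close>

definition chain_group ::
    "('g, 'a) monoid_scheme \<Rightarrow> nat set set \<Rightarrow> ('g \<Rightarrow> nat \<Rightarrow> nat) \<Rightarrow> int \<Rightarrow> (nat list \<Rightarrow> int) monoid"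
  where
  "chain_group G K \<psi> m = invariant_functions G (ordered_simplices K m) (\<lambda>g. map (\<psi> g))"

definition boundary :: "nat set set \<Rightarrow> int \<Rightarrow> (nat list \<Rightarrow> int) \<Rightarrow> (nat list \<Rightarrow> int)" where
  "boundary K m z = (\<lambda>\<tau>\<in>ordered_simplices K (m - 1).
     \<Sum>(\<sigma>, i)\<in>{(\<sigma>, i). \<sigma> \<in> ordered_simplices K m \<and> i < length \<sigma> \<and> omit i \<sigma> = \<tau>}. (-1) ^ i * z \<sigma>)"

definition equivariant_homology ::
    "('g, 'a) monoid_scheme \<Rightarrow> nat set set \<Rightarrow> ('g \<Rightarrow> nat \<Rightarrow> nat) \<Rightarrow> int \<Rightarrow>
     (nat list \<Rightarrow> int) set monoid" where
  "equivariant_homology G K \<psi> m =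
     (chain_group G K \<psi> m)
        \<lparr>carrier := kernel (chain_group G K \<psi> m) (chain_group G K \<psi> (m - 1)) (boundary K m)\<rparr>
     Mod (boundary K (m + 1) ` carrier (chain_group G K \<psi> (m + 1)))"

definition group_tuples :: "('g, 'a) monoid_scheme \<Rightarrow> nat \<Rightarrow> 'g list set" where
  "group_tuples G k = {\<Delta>. length \<Delta> = Suc k \<and> set \<Delta> \<subseteq> carrier G}"

definition cochain_group :: "('g, 'a) monoid_scheme \<Rightarrow> nat \<Rightarrow> ('g list \<Rightarrow> int) monoid" where
  "cochain_group G k = invariant_functions G (group_tuples G k) (\<lambda>g. map ((\<otimes>\<^bsub>G\<^esub>) g))"

definition coboundary ::
    "('g, 'a) monoid_scheme \<Rightarrow> nat \<Rightarrow> ('g list \<Rightarrow> int) \<Rightarrow> ('g list \<Rightarrow> int)" where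
  "coboundary G k f = (\<lambda>\<Delta>\<in>group_tuples G (Suc k). \<Sum>i\<le>Suc k. (-1) ^ i * f (omit i \<Delta>))"

definition cocycle_group :: "('g, 'a) monoid_scheme \<Rightarrow> nat \<Rightarrow> ('g list \<Rightarrow> int) monoid" where
  "cocycle_group G k = (cochain_group G k)
     \<lparr>carrier := kernel (cochain_group G k) (cochain_group G (Suc k)) (coboundary G k)\<rparr>"

definition coboundaries :: "('g, 'a) monoid_scheme \<Rightarrow> nat \<Rightarrow> ('g list \<Rightarrow> int) set" where
  "coboundaries G k = (case k of
       0 \<Rightarrow> {\<one>\<^bsub>cochain_group G 0\<^esub>}
     | Suc j \<Rightarrow> coboundary G j ` carrier (cochain_group G j))"

definition group_cohomology :: "('g, 'a) monoid_scheme \<Rightarrow> nat \<Rightarrow> ('g list \<Rightarrow> int) set monoid" where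
  "group_cohomology G k = cocycle_group G k Mod coboundaries G k"

definition cohomology_class ::
    "('g, 'a) monoid_scheme \<Rightarrow> nat \<Rightarrow> ('g list \<Rightarrow> int) \<Rightarrow> ('g list \<Rightarrow> int) set" where
  "cohomology_class G k f = coboundaries G k #>\<^bsub>cocycle_group G k\<^esub> f"

definition cohomology_unit :: "('g, 'a) monoid_scheme \<Rightarrow> ('g list \<Rightarrow> int) set" where
  "cohomology_unit G = cohomology_class G 0 (\<lambda>\<Delta>\<in>group_tuples G 0. 1)"


section \<open>Compactly supported singular cohomology of Euclidean space\<close>

text \<open>A singular cochain of degree \<open>p\<close> is an integer-valued function of which only the values at
  singular \<open>p\<close>-simplices matter.\<close>

definition cochain_eval :: "(((nat \<Rightarrow> real) \<Rightarrow> 'x) \<Rightarrow> int) \<Rightarrow> 'x chain \<Rightarrow> int" where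
  "cochain_eval \<omega> c = (\<Sum>f\<in>Poly_Mapping.keys c. Poly_Mapping.lookup c f * \<omega> f)"

definition singular_cocycle :: "nat \<Rightarrow> 'x topology \<Rightarrow> (((nat \<Rightarrow> real) \<Rightarrow> 'x) \<Rightarrow> int) \<Rightarrow> bool" where
  "singular_cocycle p X \<omega> \<longleftrightarrow>
     (\<forall>c. singular_chain (Suc p) X c \<longrightarrow> cochain_eval \<omega> (chain_boundary (Suc p) c) = 0)"

definition supported_in :: "nat \<Rightarrow> 'x topology \<Rightarrow> 'x set \<Rightarrow> (((nat \<Rightarrow> real) \<Rightarrow> 'x) \<Rightarrow> int) \<Rightarrow> bool"
  where
  "supported_in p X C \<omega> \<longleftrightarrow> (\<forall>f. singular_simplex p (subtopology X (- C)) f \<longrightarrow> \<omega> f = 0)"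

definition compactly_supported :: "nat \<Rightarrow> 'x topology \<Rightarrow> (((nat \<Rightarrow> real) \<Rightarrow> 'x) \<Rightarrow> int) \<Rightarrow> bool"
  where
  "compactly_supported p X \<omega> \<longleftrightarrow> (\<exists>C. compactin X C \<and> supported_in p X C \<omega>)"

text \<open>The last conjunct says that every class in the compactly supported cohomology of degree
  \<open>n\<close> is an integral multiple of the class of \<open>\<omega>\<close>.  For \<open>n = 0\<close> the coboundary
  term vanishes, since \<open>chain_boundary 0\<close> is zero.\<close>

definition ball_supported_generator ::
    "nat \<Rightarrow> (((nat \<Rightarrow> real) \<Rightarrow> (nat \<Rightarrow> real)) \<Rightarrow> int) \<Rightarrow> bool" where
  "ball_supported_generator n \<omega> \<longleftrightarrow>
     singular_cocycle n (Euclidean_space n) \<omega> \<and>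
     (\<exists>c\<in>topspace (Euclidean_space n). \<exists>r.
        supported_in n (Euclidean_space n) {x \<in> topspace (Euclidean_space n). Rn_dist n c x \<le> r} \<omega>) \<and>
     (\<forall>\<eta>. singular_cocycle n (Euclidean_space n) \<eta> \<and> compactly_supported n (Euclidean_space n) \<eta> \<longrightarrow>
        (\<exists>(m::int) \<theta>. compactly_supported (n - 1) (Euclidean_space n) \<theta> \<and>
           (\<forall>f. singular_simplex n (Euclidean_space n) f \<longrightarrow>
              \<eta> f = m * \<omega> f + cochain_eval \<theta> (chain_boundary n (frag_of f)))))"


section \<open>The map to group cohomology\<close>

text \<open>Finitely supported barycentric coordinates on the infinite simplex are functions on the
  group.\<close>

definition alpha_bar ::
    "('g \<Rightarrow> (nat \<Rightarrow> real) \<Rightarrow> (nat \<Rightarrow> real)) \<Rightarrow> ('g \<Rightarrow> real) \<Rightarrow> (nat \<Rightarrow> real) \<Rightarrow> (nat \<Rightarrow> real)" where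
  "alpha_bar \<alpha> t x = (\<lambda>i. \<Sum>g\<in>{g. t g \<noteq> 0}. t g * \<alpha> g x i)"

text \<open>The affine map from the standard simplex that sends the \<open>j\<close>-th vertex to \<open>ws ! j\<close>.\<close>

definition affine_simplex :: "'v list \<Rightarrow> (nat \<Rightarrow> real) \<Rightarrow> ('v \<Rightarrow> real)" where
  "affine_simplex ws t = (\<lambda>v. \<Sum>j\<in>{j. j < length ws \<and> ws ! j = v}. t j)"

text \<open>The signed sum of the monotone lattice paths from the first to the last vertex of the product
  of two ordered simplices.  The path that first traverses the left simplex has sign \<open>+\<close>; a
  step in the right factor contributes \<open>-1\<close> for each later step in the left factor.\<close>

fun staircase :: "'v list \<Rightarrow> 'w list \<Rightarrow> ('v \<times> 'w) list \<Rightarrow>\<^sub>0 int" where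
  "staircase (a # as) (b # bs) =
     (if as = [] \<and> bs = [] then frag_of [(a, b)]
      else frag_extend (\<lambda>p. frag_of ((a, b) # p)) (staircase as (b # bs))
         + frag_cmul ((-1) ^ length as)
             (frag_extend (\<lambda>p. frag_of ((a, b) # p)) (staircase (a # as) bs)))"
| "staircase [] bs = 0"
| "staircase as [] = 0"

definition product_chain ::
    "('g \<Rightarrow> (nat \<Rightarrow> real) \<Rightarrow> (nat \<Rightarrow> real)) \<Rightarrow> nat \<Rightarrow> 'g list \<Rightarrow> nat list \<Rightarrow> (nat \<Rightarrow> real) chain" where
  "product_chain \<alpha> n \<Delta> \<sigma> = frag_extend
     (\<lambda>p. frag_of (restrict
        (\<lambda>t. alpha_bar \<alpha> (affine_simplex (map fst p) t) (affine_simplex (map snd p) t))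
        (standard_simplex n)))
     (staircase \<Delta> \<sigma>)"

text \<open>The slant product.  The sum is restricted to the finitely many simplices with nonzero
  \<open>\<phi>(\<Delta> \<otimes> \<sigma>)\<close>, because sums over infinite sets are zero by convention.\<close>

definition slant ::
    "('g, 'a) monoid_scheme \<Rightarrow> nat \<Rightarrow> nat set set \<Rightarrow> ('g \<Rightarrow> (nat \<Rightarrow> real) \<Rightarrow> (nat \<Rightarrow> real)) \<Rightarrow>
     (((nat \<Rightarrow> real) \<Rightarrow> (nat \<Rightarrow> real)) \<Rightarrow> int) \<Rightarrow> nat \<Rightarrow> (nat list \<Rightarrow> int) \<Rightarrow> ('g list \<Rightarrow> int)" where
  "slant G n K \<alpha> \<omega> k z = (\<lambda>\<Delta>\<in>group_tuples G k.
     let \<phi> = (\<lambda>\<sigma>. cochain_eval \<omega> (product_chain \<alpha> n \<Delta> \<sigma>))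
     in \<Sum>\<sigma>\<in>{\<sigma> \<in> ordered_simplices K (int n - int k). \<phi> \<sigma> \<noteq> 0}. \<phi> \<sigma> * z \<sigma>)"

definition alpha_cap ::
    "('g, 'a) monoid_scheme \<Rightarrow> nat \<Rightarrow> nat set set \<Rightarrow> ('g \<Rightarrow> (nat \<Rightarrow> real) \<Rightarrow> (nat \<Rightarrow> real)) \<Rightarrow>
     (((nat \<Rightarrow> real) \<Rightarrow> (nat \<Rightarrow> real)) \<Rightarrow> int) \<Rightarrow> nat \<Rightarrow> (nat list \<Rightarrow> int) set \<Rightarrow> ('g list \<Rightarrow> int) set"
  where
  "alpha_cap G n K \<alpha> \<omega> k Z = the_elem ((\<lambda>z. cohomology_class G k (slant G n K \<alpha> \<omega> k z)) ` Z)"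

text \<open>The image of \<open>alpha_cap\<close> does not depend on the choice of \<open>\<omega>\<close>: its compactly supported
  class is unique up to sign.\<close>

definition proper_lipschitz_class ::
    "('g, 'a) monoid_scheme \<Rightarrow> 'g set \<Rightarrow> nat \<Rightarrow> ('g list \<Rightarrow> int) set \<Rightarrow> bool" where
  "proper_lipschitz_class G S k c \<longleftrightarrow>
     (\<exists>n K \<psi> \<alpha> \<omega>. proper_lipschitz_data G S n K \<psi> \<alpha> \<and> ball_supported_generator n \<omega> \<and>
        c \<in> alpha_cap G n K \<alpha> \<omega> k ` carrier (equivariant_homology G K \<psi> (int n - int k)))"

end

(* Cap product with the given cycle.  Let z be a cycle on P with slant product 1, and choose a
   Gamma-equivariant map f from the vertices of P to Gamma.  For a cocycle c on Gamma the chain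
   z cap f^*c is again a cycle on P, and its slant product is the composition of c with the map
     theta(Delta) = sum over sigma of z(sigma) phi(Delta, back face of sigma) f(front face of sigma)
   of the homogeneous bar resolution.  Up to sign theta is a chain map, because phi is a cocycle and
   z is a cycle, and it lies over the identity of Z, because the slant product of z is 1.  Hence it is
   equivariantly homotopic to the identity, and the slant product of z cap f^*c is cohomologous
   to c.  The same data (P, alpha) therefore serve for all classes. *)

theory Submission
  imports Defs
begin

section \<open>Cochains on ordered simplices\<close>

text \<open>Chains on P are infinite, so identities between them are not computed directly. Each one
  is paired with a finitely supported cochain: the boundary then turns into \<open>codiff\<close>
  and the cap product into a cup product. Local finiteness of P, together with properness and the
  Lipschitz bound of \<open>\<alpha>\<close>, keeps every such sum finite; much of the work is to
  find one finite index set for all sums in an identity. A simplex is a list, of dimension one less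
  than its length, and the empty list of dimension -1 carries the augmentation. Thus
  \<open>codiff\<close> is the augmented coboundary, with value \<open>F []\<close> on a list of
  length one, and the degree is read off the argument. This makes the comparison of theta with the
  identity uniform in all degrees: lying over the identity of Z is the statement in dimension -1.
  Theta lies over the identity exactly, not only up to homotopy, because 0 is the only coboundary in
  degree 0, so the slant product of z is the constant function 1 itself.\<close>

definition codiff :: "('v list \<Rightarrow> int) \<Rightarrow> 'v list \<Rightarrow> int" where
  "codiff F xs = (\<Sum>i<length xs. (-1) ^ i * F (omit i xs))"

lemma omit_0_Cons [simp]: "omit 0 (x # xs) = xs"
  by (simp add: omit_def)

lemma omit_Suc_Cons [simp]: "omit (Suc i) (x # xs) = x # omit i xs"
  by (simp add: omit_def)

lemma length_omit: "i < length xs \<Longrightarrow> length (omit i xs) = length xs - 1"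
  by (auto simp: omit_def)

lemma set_omit_subset: "set (omit i xs) \<subseteq> set xs"
  unfolding omit_def using set_take_subset set_drop_subset by fastforce

lemma omit_map: "omit i (map f xs) = map f (omit i xs)"
  by (simp add: omit_def take_map drop_map)

lemma nth_omit:
  assumes "i \<le> length xs" "j < length xs - 1"
  shows "omit i xs ! j = (if j < i then xs ! j else xs ! Suc j)"
  using assms by (auto simp: omit_def nth_append min_def)

lemma codiff_Nil [simp]: "codiff F [] = 0"
  by (simp add: codiff_def)

text \<open>The face without the head is split off; all other faces keep the head. The recursion
  passes from \<open>F\<close> to \<open>\<lambda>p. F (x # p)\<close>, so the inductions on lists
  below leave the cochain arbitrary.\<close>

lemma codiff_Cons: "codiff F (x # xs) = F xs - codiff (\<lambda>p. F (x # p)) xs"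
  by (simp add: codiff_def sum.lessThan_Suc_shift sum_negf del: sum.lessThan_Suc)

lemma codiff_cong:
  assumes "\<And>i. i < length xs \<Longrightarrow> F (omit i xs) = F' (omit i xs)"
  shows "codiff F xs = codiff F' xs"
  unfolding codiff_def using assms by (intro sum.cong) auto

lemma codiff_diff: "codiff (\<lambda>p. F p - F' p) xs = codiff F xs - codiff F' xs"
  by (simp add: codiff_def algebra_simps sum_subtractf)

lemma codiff_add: "codiff (\<lambda>p. F p + F' p) xs = codiff F xs + codiff F' xs"
  by (simp add: codiff_def algebra_simps sum.distrib)

lemma codiff_scale: "codiff (\<lambda>p. a * F p) xs = a * codiff F xs"
  by (simp add: codiff_def sum_distrib_left mult_ac)

lemma codiff_sum: "codiff (\<lambda>p. \<Sum>a\<in>A. F a p) xs = (\<Sum>a\<in>A. codiff (F a) xs)"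
  unfolding codiff_def sum_distrib_left by (rule sum.swap)

lemma codiff_zero [simp]: "codiff (\<lambda>p. 0) xs = 0"
  by (simp add: codiff_def)

lemma codiff_map: "codiff F (map f xs) = codiff (\<lambda>p. F (map f p)) xs"
  by (simp add: codiff_def omit_map)

text \<open>Leibniz rule for the cup product of a cochain of degree \<open>k\<close> with
  \<open>F\<close>; front and back face share the vertex at position \<open>k\<close>. With
  \<open>F [] = 0\<close> it holds for lists of every length, including those whose back face is
  empty.\<close>

lemma codiff_cup:
  assumes "F [] = 0"
  shows "codiff (\<lambda>p. c (take (Suc k) p) * F (drop k p)) xs =
           codiff c (take (Suc (Suc k)) xs) * F (drop (Suc k) xs)
           + (-1) ^ k * c (take (Suc k) xs) * codiff F (drop k xs)"
proof (induction k arbitrary: c xs)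
  case 0
  show ?case
  proof (cases xs)
    case (Cons x ys)
    then show ?thesis using assms
      by (cases ys) (simp_all add: codiff_Cons codiff_scale algebra_simps)
  qed simp
next
  case (Suc k)
  show ?case
  proof (cases xs)
    case (Cons x ys)
    show ?thesis
      using Suc.IH [of "\<lambda>p. c (x # p)" ys]
      by (simp add: Cons codiff_Cons algebra_simps)
  qed simp
qed

subsection \<open>Evaluation on chains\<close>

text \<open>\<open>cochain_eval\<close> over arbitrary generators: staircases are sums of lists of
  pairs, which become singular simplices only later.\<close>

definition frag_eval :: "('a \<Rightarrow> int) \<Rightarrow> ('a \<Rightarrow>\<^sub>0 int) \<Rightarrow> int" where
  "frag_eval F c = (\<Sum>x\<in>Poly_Mapping.keys c. Poly_Mapping.lookup c x * F x)"

lemma cochain_eval_eq_frag_eval: "cochain_eval = frag_eval"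
  by (simp add: fun_eq_iff cochain_eval_def frag_eval_def)

lemma frag_eval_superset:
  assumes "finite A" "Poly_Mapping.keys c \<subseteq> A"
  shows "frag_eval F c = (\<Sum>x\<in>A. Poly_Mapping.lookup c x * F x)"
  unfolding frag_eval_def using assms
  by (intro sum.mono_neutral_left) (auto simp: in_keys_iff)

lemma frag_eval_0 [simp]: "frag_eval F 0 = 0"
  by (simp add: frag_eval_def)

lemma frag_eval_of [simp]: "frag_eval F (frag_of x) = F x"
  by (simp add: frag_eval_def)

lemma frag_eval_add [simp]: "frag_eval F (c + d) = frag_eval F c + frag_eval F d"
proof -
  define A where "A = Poly_Mapping.keys c \<union> Poly_Mapping.keys d"
  have A: "finite A" "Poly_Mapping.keys (c + d) \<subseteq> A" "Poly_Mapping.keys c \<subseteq> A"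
    "Poly_Mapping.keys d \<subseteq> A"
    using keys_add [of c d] by (auto simp: A_def)
  show ?thesis
    unfolding A(2-4) [THEN frag_eval_superset [OF A(1)]]
    by (simp add: lookup_add distrib_right sum.distrib)
qed

lemma frag_eval_cmul [simp]: "frag_eval F (frag_cmul a c) = a * frag_eval F c"
proof -
  have "Poly_Mapping.keys (frag_cmul a c) \<subseteq> Poly_Mapping.keys c" by (rule keys_cmul)
  from frag_eval_superset [OF finite_keys this] show ?thesis
    by (simp add: frag_eval_def [of F c] sum_distrib_left mult_ac)
qed

lemma frag_eval_sum: "frag_eval F (\<Sum>a\<in>A. c a) = (\<Sum>a\<in>A. frag_eval F (c a))"
  by (induction A rule: infinite_finite_induct) auto

lemma frag_eval_extend: "frag_eval F (frag_extend g c) = frag_eval (\<lambda>x. frag_eval F (g x)) c"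
  by (simp add: frag_extend_def frag_eval_sum frag_eval_def [of _ c])

lemma frag_eval_cong:
  "(\<And>x. x \<in> Poly_Mapping.keys c \<Longrightarrow> F x = F' x) \<Longrightarrow> frag_eval F c = frag_eval F' c"
  by (simp add: frag_eval_def)

lemma frag_eval_eq_0: "(\<And>x. x \<in> Poly_Mapping.keys c \<Longrightarrow> F x = 0) \<Longrightarrow> frag_eval F c = 0"
  by (simp add: frag_eval_def)

lemma frag_eval_diff_left: "frag_eval (\<lambda>x. F x - F' x) c = frag_eval F c - frag_eval F' c"
  by (simp add: frag_eval_def algebra_simps sum_subtractf)

subsection \<open>The staircase triangulation\<close>

lemma staircase_Nil2 [simp]: "staircase as [] = 0"
  by (cases as) auto

text \<open>If both tails are empty, both recursive staircases are 0; so the case distinction in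
  \<open>staircase\<close> can be written as an extra summand.\<close>

lemma frag_eval_staircase_Cons:
  "frag_eval F (staircase (a # as) (b # bs)) =
     frag_eval (\<lambda>p. F ((a, b) # p)) (staircase as (b # bs))
     + (-1) ^ length as * frag_eval (\<lambda>p. F ((a, b) # p)) (staircase (a # as) bs)
     + (if as = [] \<and> bs = [] then F [(a, b)] else 0)"
  by (auto simp: frag_eval_extend)

lemma keys_staircase:
  assumes "p \<in> Poly_Mapping.keys (staircase as bs)"
  shows "Suc (length p) = length as + length bs" "set (map fst p) \<subseteq> set as"
    "set (map snd p) \<subseteq> set bs"
proof -
  let ?P = "\<lambda>as bs p. Suc (length p) = length as + length bs \<and> set (map fst p) \<subseteq> set as
     \<and> set (map snd p) \<subseteq> set bs"
  have "\<forall>p\<in>Poly_Mapping.keys (staircase as bs). ?P as bs p"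
  proof (induction as bs rule: staircase.induct)
    case (1 a as b bs)
    show ?case
    proof (cases "as = [] \<and> bs = []")
      case False
      have ext: "Poly_Mapping.keys (frag_extend (\<lambda>p. frag_of ((a, b) # p)) c)
          \<subseteq> (\<lambda>p. (a, b) # p) ` Poly_Mapping.keys c" for c :: "('a \<times> 'b) list \<Rightarrow>\<^sub>0 int"
        using keys_frag_extend [of "\<lambda>p. frag_of ((a, b) # p)" c] by auto
      have "p \<in> (\<lambda>p. (a, b) # p) ` (Poly_Mapping.keys (staircase as (b # bs))
             \<union> Poly_Mapping.keys (staircase (a # as) bs))"
        if "p \<in> Poly_Mapping.keys (staircase (a # as) (b # bs))" for p
        using that False ext [of "staircase as (b # bs)"] ext [of "staircase (a # as) bs"]
        by (auto simp: image_Un split: if_splits dest!: subsetD [OF keys_add] subsetD [OF keys_cmul])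
      then have *: "\<exists>q. p = (a, b) # q \<and> (?P as (b # bs) q \<or> ?P (a # as) bs q)"
        if "p \<in> Poly_Mapping.keys (staircase (a # as) (b # bs))" for p
        using that 1(1) [OF False] 1(2) [OF False] by blast
      show ?thesis
      proof
        fix p assume "p \<in> Poly_Mapping.keys (staircase (a # as) (b # bs))"
        then obtain q where "p = (a, b) # q" "?P as (b # bs) q \<or> ?P (a # as) bs q"
          using * by blast
        then show "?P (a # as) (b # bs) p" by auto
      qed
    qed auto
  qed auto
  with assms show "Suc (length p) = length as + length bs" "set (map fst p) \<subseteq> set as"
    "set (map snd p) \<subseteq> set bs" by auto
qed

lemma frag_eval_staircase_map:
  "frag_eval F (staircase (map f as) (map g bs)) =
     frag_eval (\<lambda>p. F (map (map_prod f g) p)) (staircase as bs)"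
  by (induction as bs arbitrary: F rule: staircase.induct)
    (simp_all add: frag_eval_staircase_Cons del: staircase.simps(1))

text \<open>The last summand is the augmentation: it is the only contribution of the empty list, which
  is a face of a list of length one.\<close>

lemma codiff_staircase:
  "frag_eval (codiff F) (staircase as bs) =
     codiff (\<lambda>as'. frag_eval F (staircase as' bs)) as
     - (-1) ^ length as * codiff (\<lambda>bs'. frag_eval F (staircase as bs')) bs
     + (if length as = 1 \<and> length bs = 1 then F [] else 0)"
proof (induction as bs arbitrary: F rule: staircase.induct)
  case (1 a as b bs)
  let ?G = "\<lambda>p. F ((a, b) # p)"
  have IH1: "frag_eval (codiff ?G) (staircase as (b # bs)) =
     codiff (\<lambda>as'. frag_eval ?G (staircase as' (b # bs))) as
     - (-1) ^ length as * codiff (\<lambda>bs'. frag_eval ?G (staircase as bs')) (b # bs)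
     + (if length as = 1 \<and> bs = [] then F [(a, b)] else 0)"
    using 1(1) [of ?G] by (cases "as = [] \<and> bs = []") auto
  have IH2: "frag_eval (codiff ?G) (staircase (a # as) bs) =
     codiff (\<lambda>as'. frag_eval ?G (staircase as' bs)) (a # as)
     - (-1) ^ length (a # as) * codiff (\<lambda>bs'. frag_eval ?G (staircase (a # as) bs')) bs
     + (if as = [] \<and> length bs = 1 then F [(a, b)] else 0)"
    using 1(2) [of ?G] by (cases "as = [] \<and> bs = []") auto
  \<comment> \<open>The extra summand of the staircase recursion is supported at the empty list, so
    its coboundary lives on lists of length one.\<close>
  have aug: "codiff (\<lambda>p. if p = [] \<and> P then x else 0) cs = (if length cs = 1 \<and> P then x else 0)"
    for P :: bool and x :: int and cs :: "'c list"
    by (cases cs rule: remdups_adj.cases) (auto simp: codiff_Cons)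
  have aug': "codiff (\<lambda>p. if P \<and> p = [] then x else 0) cs = (if length cs = 1 \<and> P then x else 0)"
    for P :: bool and x :: int and cs :: "'c list"
    using aug [of P x cs] by (simp add: conj_commute)
  define s :: int where "s = (-1) ^ length as"
  have ss: "s * (s * x) = x" for x
    by (simp add: s_def flip: power_add mult.assoc)
  have L: "frag_eval (codiff F) (staircase (a # as) (b # bs)) =
      frag_eval F (staircase as (b # bs)) - frag_eval (codiff ?G) (staircase as (b # bs))
      + s * (frag_eval F (staircase (a # as) bs) - frag_eval (codiff ?G) (staircase (a # as) bs))
      + (if as = [] \<and> bs = [] then F [] else 0)"
    by (simp add: frag_eval_staircase_Cons codiff_Cons frag_eval_diff_left s_def del: staircase.simps(1))
  have "codiff (\<lambda>x. frag_eval F (staircase (a # x) (b # bs))) as =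
     codiff (\<lambda>x. frag_eval ?G (staircase x (b # bs)) + - s * frag_eval ?G (staircase (a # x) bs)
        + (if x = [] \<and> bs = [] then F [(a, b)] else 0)) as"
  proof (rule codiff_cong)
    \<comment> \<open>Omitting an entry shortens \<open>as\<close> by one, which turns the sign of
      the second summand into \<open>- s\<close>.\<close>
    fix i assume "i < length as"
    then have "(-1) ^ length (omit i as) = - s"
      by (cases as) (auto simp: length_omit s_def)
    then show "frag_eval F (staircase (a # omit i as) (b # bs)) =
        frag_eval ?G (staircase (omit i as) (b # bs)) + - s * frag_eval ?G (staircase (a # omit i as) bs)
        + (if omit i as = [] \<and> bs = [] then F [(a, b)] else 0)"
      by (simp only: frag_eval_staircase_Cons)
  qed
  then have R1: "codiff (\<lambda>x. frag_eval F (staircase (a # x) (b # bs))) as =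
     codiff (\<lambda>x. frag_eval ?G (staircase x (b # bs))) as
     - s * codiff (\<lambda>x. frag_eval ?G (staircase (a # x) bs)) as
     + (if length as = 1 \<and> bs = [] then F [(a, b)] else 0)"
    by (simp add: codiff_add codiff_diff codiff_scale aug del: staircase.simps(1))
  have R2: "codiff (\<lambda>y. frag_eval F (staircase (a # as) (b # y))) bs =
     codiff (\<lambda>y. frag_eval ?G (staircase as (b # y))) bs
     + s * codiff (\<lambda>y. frag_eval ?G (staircase (a # as) y)) bs
     + (if length bs = 1 \<and> as = [] then F [(a, b)] else 0)"
    by (simp add: frag_eval_staircase_Cons codiff_add codiff_scale aug' s_def del: staircase.simps(1))
  \<comment> \<open>The interior walls cancel: \<open>frag_eval ?G (staircase as bs)\<close>, which
    stems from paths whose first corner after \<open>(a, b)\<close> is cut off, enters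
    \<open>L\<close> with sign \<open>s\<close> through \<open>IH1\<close> and with
    \<open>- s\<close> through \<open>IH2\<close>.\<close>
  show ?case
    unfolding L IH1 IH2 codiff_Cons R1 R2 by (simp add: algebra_simps ss flip: s_def)
qed auto

section \<open>An explicit homotopy on the bar resolution\<close>

text \<open>The homotopy comes from the contraction of the infinite simplex to the first vertex of the
  argument, which keeps it equivariant.\<close>

fun cone_homotopy :: "(('v list \<Rightarrow> int) \<Rightarrow> 'v list \<Rightarrow> int) \<Rightarrow> ('v list \<Rightarrow> int) \<Rightarrow> 'v list \<Rightarrow> int" where
  "cone_homotopy T c [] = 0"
| "cone_homotopy T c (a # as) = T (\<lambda>p. c (a # p)) (a # as) - cone_homotopy T (\<lambda>p. c (a # p)) as"

lemma cone_homotopy_diff: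
  assumes "\<And>c d xs. T (\<lambda>p. c p - d p) xs = T c xs - T d xs"
  shows "cone_homotopy T (\<lambda>p. c p - d p) xs = cone_homotopy T c xs - cone_homotopy T d xs"
  by (induction xs arbitrary: c d) (simp_all add: assms)

text \<open>\<open>T\<close> stands for the pull-back of cochains along an augmented chain map; the
  assumption on the empty list says that it is the identity on the augmentation. That list starts
  the induction, so degree 0 is not special. In the step, \<open>codiff_Cons\<close> expands both
  terms, and what remains is the commutation of \<open>T\<close> with \<open>codiff\<close> for the
  cochain with first vertex \<open>a\<close> fixed.\<close>

lemma cone_homotopy_codiff:
  assumes diff: "\<And>c d xs. T (\<lambda>p. c p - d p) xs = T c xs - T d xs"
    and Nil: "\<And>c. T c [] = c []"
    and comm: "\<And>c xs. set xs \<subseteq> V \<Longrightarrow> T (codiff c) xs = codiff (T c) xs"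
    and "set xs \<subseteq> V"
  shows "cone_homotopy T (codiff c) xs + codiff (cone_homotopy T c) xs = T c xs - c xs"
  using \<open>set xs \<subseteq> V\<close>
proof (induction xs arbitrary: c)
  case (Cons a as)
  let ?c = "\<lambda>p. c (a # p)"
  have IH: "cone_homotopy T (codiff ?c) as + codiff (cone_homotopy T ?c) as = T ?c as - ?c as"
    using Cons by simp
  have "T (codiff ?c) (a # as) = T ?c as - codiff (\<lambda>p. T ?c (a # p)) as"
    using comm [of "a # as" ?c] Cons.prems by (simp add: codiff_Cons)
  then show ?case
    using IH by (simp add: codiff_Cons codiff_diff diff cone_homotopy_diff)
qed (simp add: Nil)

text \<open>The homotopy reads a cochain only one degree up and on lists over \<open>V\<close>.
  Cocycle and invariance conditions are known only there and enter through this fact.\<close>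

lemma cone_homotopy_cong:
  assumes "\<And>c d xs. set xs \<subseteq> V \<Longrightarrow> (\<And>p. length p = length xs \<Longrightarrow> set p \<subseteq> V \<Longrightarrow> c p = d p)
      \<Longrightarrow> T c xs = T d xs"
    and "set xs \<subseteq> V" and "\<And>p. length p = Suc (length xs) \<Longrightarrow> set p \<subseteq> V \<Longrightarrow> c p = d p"
  shows "cone_homotopy T c xs = cone_homotopy T d xs"
  using assms(2,3)
proof (induction xs arbitrary: c d)
  case (Cons a as)
  have "T (\<lambda>p. c (a # p)) (a # as) = T (\<lambda>p. d (a # p)) (a # as)"
    using Cons.prems by (intro assms(1)) auto
  moreover have "cone_homotopy T (\<lambda>p. c (a # p)) as = cone_homotopy T (\<lambda>p. d (a # p)) as"
    using Cons.prems by (intro Cons.IH) auto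
  ultimately show ?case by simp
qed simp

lemma cone_homotopy_map:
  assumes "\<And>c xs. set xs \<subseteq> V \<Longrightarrow> T c (map g xs) = T (\<lambda>p. c (map g p)) xs" and "set xs \<subseteq> V"
  shows "cone_homotopy T c (map g xs) = cone_homotopy T (\<lambda>p. c (map g p)) xs"
  using assms(2)
proof (induction xs arbitrary: c)
  case (Cons a as)
  have "T (\<lambda>p. c (g a # p)) (map g (a # as)) = T (\<lambda>p. c (map g (a # p))) (a # as)"
    using assms(1) [of "a # as" "\<lambda>p. c (g a # p)"] Cons.prems by simp
  then show ?case using Cons by simp
qed simp

section \<open>Locally finite chains\<close>

lemma ordered_simplices_nonempty:
  "simplicial_complex K \<Longrightarrow> \<sigma> \<in> ordered_simplices K m \<Longrightarrow> \<sigma> \<noteq> []"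
  by (auto simp: ordered_simplices_def simplicial_complex_def)

lemma finite_ordered_simplices_containing:
  assumes K: "simplicial_complex K" "locally_finite_complex K"
  shows "finite {\<sigma> \<in> ordered_simplices K m. v \<in> set \<sigma>}"
proof (cases "v \<in> \<Union>K")
  case True
  let ?S = "{s \<in> K. v \<in> s}"
  have "finite ?S" using K True by (auto simp: locally_finite_complex_def)
  moreover have "\<forall>s\<in>?S. finite s" using K by (auto simp: simplicial_complex_def)
  ultimately have "finite (\<Union>?S)" by auto
  from finite_lists_length_eq [OF this, of "nat (m + 1)"]
  show ?thesis
    by (rule rev_finite_subset) (auto simp: ordered_simplices_def)
next
  case False
  then have "{\<sigma> \<in> ordered_simplices K m. v \<in> set \<sigma>} = {}"
    by (auto simp: ordered_simplices_def)
  then show ?thesis by (simp only: finite.emptyI)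
qed

text \<open>The face of a one-vertex list is empty and is no ordered simplex. In the pairings below
  this exception is absorbed by \<open>F [] = 0\<close>.\<close>

lemma omit_ordered_simplices:
  assumes "simplicial_complex K" "\<sigma> \<in> ordered_simplices K m" "i < length \<sigma>"
  shows "omit i \<sigma> \<in> ordered_simplices K (m - 1) \<or> omit i \<sigma> = []"
proof (cases "omit i \<sigma> = []")
  case False
  have "set \<sigma> \<in> K" "set (omit i \<sigma>) \<noteq> {}"
    using assms False by (auto simp: ordered_simplices_def)
  then have "set (omit i \<sigma>) \<in> K"
    using assms(1) set_omit_subset [of i \<sigma>] unfolding simplicial_complex_def by blast
  moreover have "length \<sigma> > 0" using assms by auto
  ultimately show ?thesis
    using assms by (auto simp: ordered_simplices_def length_omit of_nat_diff)
qed simp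

lemma drop_ordered_simplices:
  assumes "simplicial_complex K" "\<sigma> \<in> ordered_simplices K m" "drop k \<sigma> \<noteq> []"
  shows "drop k \<sigma> \<in> ordered_simplices K (m - int k)"
proof -
  have "set \<sigma> \<in> K" "set (drop k \<sigma>) \<noteq> {}"
    using assms by (auto simp: ordered_simplices_def)
  then have "set (drop k \<sigma>) \<in> K"
    using assms(1) set_drop_subset [of k \<sigma>] unfolding simplicial_complex_def by blast
  then show ?thesis
    using assms by (auto simp: ordered_simplices_def of_nat_diff)
qed

text \<open>Local finiteness in the form used below. One vertex of each \<open>\<tau>\<close>
  suffices, which is why the empty list is excluded.\<close>

lemma finite_ordered_simplices_over:
  assumes K: "simplicial_complex K" "locally_finite_complex K"
    and "finite T" "[] \<notin> T" "\<And>\<sigma>. \<sigma> \<in> A \<Longrightarrow> \<sigma> \<in> ordered_simplices K m \<and> (\<exists>\<tau>\<in>T. set \<tau> \<subseteq> set \<sigma>)"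
  shows "finite A"
proof -
  have "A \<subseteq> (\<Union>\<tau>\<in>T. {\<sigma> \<in> ordered_simplices K m. hd \<tau> \<in> set \<sigma>})"
  proof
    fix \<sigma> assume "\<sigma> \<in> A"
    with assms(5) obtain \<tau> where "\<tau> \<in> T" "set \<tau> \<subseteq> set \<sigma>" "\<sigma> \<in> ordered_simplices K m"
      by blast
    moreover from this assms(4) have "hd \<tau> \<in> set \<tau>" by (intro hd_in_set) auto
    ultimately show "\<sigma> \<in> (\<Union>\<tau>\<in>T. {\<sigma> \<in> ordered_simplices K m. hd \<tau> \<in> set \<sigma>})" by blast
  qed
  then show ?thesis
    by (rule finite_subset) (intro finite_UN_I finite_ordered_simplices_containing K \<open>finite T\<close>)
qed

lemma finite_omit_support:
  assumes K: "simplicial_complex K" "locally_finite_complex K"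
    and F: "F [] = (0::int)" "finite {\<tau> \<in> ordered_simplices K (m - 1). F \<tau> \<noteq> 0}"
  shows "finite {\<sigma> \<in> ordered_simplices K m. \<exists>i<length \<sigma>. F (omit i \<sigma>) \<noteq> 0}"
proof (rule finite_ordered_simplices_over [OF K F(2)])
  fix \<sigma> assume \<sigma>: "\<sigma> \<in> {\<sigma> \<in> ordered_simplices K m. \<exists>i<length \<sigma>. F (omit i \<sigma>) \<noteq> 0}"
  then obtain i where i: "i < length \<sigma>" "F (omit i \<sigma>) \<noteq> 0" by auto
  with \<sigma> F(1) omit_ordered_simplices [OF K(1), of \<sigma> m i]
  have "omit i \<sigma> \<in> {\<tau> \<in> ordered_simplices K (m - 1). F \<tau> \<noteq> 0}" by auto
  then have "\<exists>\<tau>\<in>{\<tau> \<in> ordered_simplices K (m - 1). F \<tau> \<noteq> 0}. set \<tau> \<subseteq> set \<sigma>"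
    using set_omit_subset by (rule bexI [rotated])
  with \<sigma> show "\<sigma> \<in> ordered_simplices K m \<and>
      (\<exists>\<tau>\<in>{\<tau> \<in> ordered_simplices K (m - 1). F \<tau> \<noteq> 0}. set \<tau> \<subseteq> set \<sigma>)" by simp
qed (simp add: F)

text \<open>Adjunction of \<open>boundary\<close> and \<open>codiff\<close>: both sides sum over
  pairs of a simplex and a position, grouped by face on the left. Only \<open>F\<close> has finite
  support; \<open>y\<close> may be an infinite chain. \<open>A\<close> can be any finite set that
  contains the simplices with a face in that support, so that several pairings can share it.\<close>

lemma sum_boundary:
  assumes K: "simplicial_complex K" "locally_finite_complex K"
    and F: "F [] = (0::int)" "finite {\<tau> \<in> ordered_simplices K (m - 1). F \<tau> \<noteq> 0}"
    and A: "finite A" "A \<subseteq> ordered_simplices K m"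
      "\<And>\<sigma> i. \<sigma> \<in> ordered_simplices K m \<Longrightarrow> i < length \<sigma> \<Longrightarrow> F (omit i \<sigma>) \<noteq> 0 \<Longrightarrow> \<sigma> \<in> A"
  shows "(\<Sum>\<tau>\<in>{\<tau> \<in> ordered_simplices K (m - 1). F \<tau> \<noteq> 0}. F \<tau> * boundary K m y \<tau>) =
           (\<Sum>\<sigma>\<in>A. codiff F \<sigma> * y \<sigma>)"
proof -
  let ?T = "{\<tau> \<in> ordered_simplices K (m - 1). F \<tau> \<noteq> 0}"
  let ?g = "\<lambda>(\<sigma>, i). (-1) ^ i * F (omit i \<sigma>) * y \<sigma>"
  let ?P = "Sigma A (\<lambda>\<sigma>. {..<length \<sigma>})"
  let ?Q = "{(\<sigma>, i) \<in> ?P. F (omit i \<sigma>) \<noteq> 0}"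
  have finP: "finite ?P" using A by auto
  have "(\<Sum>\<sigma>\<in>A. codiff F \<sigma> * y \<sigma>) = sum ?g ?P"
    using A by (simp add: codiff_def sum_distrib_right sum.Sigma)
  \<comment> \<open>This also removes the pairs with an empty face, as \<open>F [] = 0\<close>; all
    remaining faces lie in \<open>?T\<close>.\<close>
  also have "\<dots> = sum ?g ?Q"
    using finP by (intro sum.mono_neutral_right) auto
  also have "\<dots> = (\<Sum>\<tau>\<in>?T. sum ?g {x \<in> ?Q. (\<lambda>(\<sigma>, i). omit i \<sigma>) x = \<tau>})"
  proof (rule sum.group [symmetric])
    show "finite ?Q" using finP by (rule rev_finite_subset) auto
    show "(\<lambda>(\<sigma>, i). omit i \<sigma>) ` ?Q \<subseteq> ?T"
    proof
      fix \<tau> assume "\<tau> \<in> (\<lambda>(\<sigma>, i). omit i \<sigma>) ` ?Q"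
      then obtain \<sigma> i where "\<sigma> \<in> A" "i < length \<sigma>" "F (omit i \<sigma>) \<noteq> 0" "\<tau> = omit i \<sigma>" by auto
      moreover from this A(2) have "\<sigma> \<in> ordered_simplices K m" by blast
      moreover have "omit i \<sigma> \<noteq> []" using \<open>F (omit i \<sigma>) \<noteq> 0\<close> F(1) by metis
      ultimately show "\<tau> \<in> ?T" using omit_ordered_simplices [OF K(1), of \<sigma> m i] by simp
    qed
  qed (rule F(2))
  also have "\<dots> = (\<Sum>\<tau>\<in>?T. F \<tau> * boundary K m y \<tau>)"
  proof (rule sum.cong)
    fix \<tau> assume \<tau>: "\<tau> \<in> ?T"
    let ?B = "{(\<sigma>, i). \<sigma> \<in> ordered_simplices K m \<and> i < length \<sigma> \<and> omit i \<sigma> = \<tau>}"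
    have "\<sigma> \<in> A" if "\<sigma> \<in> ordered_simplices K m" "i < length \<sigma>" "omit i \<sigma> = \<tau>" for \<sigma> i
      using A(3) [OF that(1,2)] that(3) \<tau> by simp
    then have "{x \<in> ?Q. (\<lambda>(\<sigma>, i). omit i \<sigma>) x = \<tau>} = ?B"
      using \<tau> subsetD [OF A(2)] by auto
    then have "sum ?g {x \<in> ?Q. (\<lambda>(\<sigma>, i). omit i \<sigma>) x = \<tau>} = sum ?g ?B"
      by (rule arg_cong)
    also have "\<dots> = (\<Sum>(\<sigma>, i)\<in>?B. F \<tau> * ((-1) ^ i * y \<sigma>))"
      by (rule sum.cong) auto
    also have "\<dots> = F \<tau> * boundary K m y \<tau>"
      using \<tau> by (simp add: boundary_def sum_distrib_left case_prod_unfold)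
    finally show "sum ?g {x \<in> ?Q. (\<lambda>(\<sigma>, i). omit i \<sigma>) x = \<tau>} = F \<tau> * boundary K m y \<tau>" .
  qed auto
  finally show ?thesis by simp
qed

section \<open>Slant and cap products\<close>

lemma bij_betw_Collect:
  assumes "bij_betw h A B" "\<And>a. a \<in> A \<Longrightarrow> P (h a) \<longleftrightarrow> Q a"
  shows "bij_betw h {a \<in> A. Q a} {b \<in> B. P b}"
  using assms unfolding bij_betw_def by (auto intro: inj_on_subset)

text \<open>The properties of the pairing on which the algebra rests, free of topology. A list of
  length l has dimension l - 1, so total degree \<open>n\<close> is total length
  \<open>n + 2\<close>, and the cocycle condition lives at total length \<open>n + 3\<close>. The
  map \<open>f\<close> is given on vertices only: all tuples of group elements are simplices of the
  infinite simplex, so it is automatically simplicial.\<close>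

locale equivariant_slant = group G for G (structure) +
  fixes K :: "nat set set" and \<psi> :: "'a \<Rightarrow> nat \<Rightarrow> nat" and n :: nat
    and \<phi> :: "'a list \<Rightarrow> nat list \<Rightarrow> int" and f :: "nat \<Rightarrow> 'a"
  assumes complex: "simplicial_complex K" and loc_fin: "locally_finite_complex K"
    and act: "group_action G (\<Union>K) \<psi>"
    and act_K: "\<And>g s. g \<in> carrier G \<Longrightarrow> s \<in> K \<Longrightarrow> \<psi> g ` s \<in> K"
    and \<phi>_Nil: "\<And>\<Delta>. \<phi> \<Delta> [] = 0" "\<And>\<sigma>. \<phi> [] \<sigma> = 0"
    and \<phi>_finite: "\<And>\<Delta> m. set \<Delta> \<subseteq> carrier G \<Longrightarrow> int (length \<Delta>) + m = int n + 1 \<Longrightarrow>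
        finite {\<sigma> \<in> ordered_simplices K m. \<phi> \<Delta> \<sigma> \<noteq> 0}"
    and \<phi>_act: "\<And>g \<Delta> \<sigma>. g \<in> carrier G \<Longrightarrow> set \<Delta> \<subseteq> carrier G \<Longrightarrow> set \<sigma> \<in> K \<Longrightarrow>
        length \<Delta> + length \<sigma> = n + 2 \<Longrightarrow> \<phi> (map ((\<otimes>) g) \<Delta>) (map (\<psi> g) \<sigma>) = \<phi> \<Delta> \<sigma>"
    and \<phi>_codiff: "\<And>\<Delta> \<sigma>. set \<Delta> \<subseteq> carrier G \<Longrightarrow> set \<sigma> \<in> K \<Longrightarrow> length \<Delta> + length \<sigma> = n + 3 \<Longrightarrow>
        codiff (\<phi> \<Delta>) \<sigma> = (-1) ^ length \<Delta> * codiff (\<lambda>\<Delta>'. \<phi> \<Delta>' \<sigma>) \<Delta>"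
    and f_closed: "\<And>v. v \<in> \<Union>K \<Longrightarrow> f v \<in> carrier G"
    and f_act: "\<And>g v. g \<in> carrier G \<Longrightarrow> v \<in> \<Union>K \<Longrightarrow> f (\<psi> g v) = g \<otimes> f v"
begin

abbreviation "splx m \<equiv> ordered_simplices K m"

lemma bij_betw_splx:
  assumes g: "g \<in> carrier G"
  shows "bij_betw (map (\<psi> g)) (splx m) (splx m)"
proof -
  interpret group_action G "\<Union>K" \<psi> by (rule act)
  have sub: "set \<sigma> \<subseteq> \<Union>K" if "\<sigma> \<in> splx m" for \<sigma>
    using that by (auto simp: ordered_simplices_def)
  have inv: "\<psi> (inv h) (\<psi> h v) = v" if "v \<in> \<Union>K" "h \<in> carrier G" for v h
    using that orbit_sym_aux by blast
  have closed: "map (\<psi> h) \<sigma> \<in> splx m" if "\<sigma> \<in> splx m" "h \<in> carrier G" for \<sigma> h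
    using that act_K by (auto simp: ordered_simplices_def)
  have inv': "map (\<psi> (inv h)) (map (\<psi> h) \<sigma>) = \<sigma>" if "\<sigma> \<in> splx m" "h \<in> carrier G" for \<sigma> h
    using inv that sub [OF that(1)] by (auto simp: map_idI subset_iff)
  show ?thesis
    using g inv' [of _ g] inv' [of _ "inv g"] closed
    by (intro bij_betw_byWitness [where f' = "map (\<psi> (inv g))"]) auto
qed

lemma f_map_act:
  assumes "g \<in> carrier G" "set \<sigma> \<subseteq> \<Union>K"
  shows "map f (map (\<psi> g) \<sigma>) = map ((\<otimes>) g) (map f \<sigma>)"
  using assms f_act by auto

lemma f_map_closed: "\<sigma> \<in> splx m \<Longrightarrow> set (map f (take k \<sigma>)) \<subseteq> carrier G"
  using f_closed by (auto simp: ordered_simplices_def dest!: in_set_takeD)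

lemma \<phi>_act_drop:
  assumes "g \<in> carrier G" "set \<Delta> \<subseteq> carrier G" "\<sigma> \<in> splx m"
    "int (length \<Delta>) + m - int k = int n + 1"
  shows "\<phi> (map ((\<otimes>) g) \<Delta>) (drop k (map (\<psi> g) \<sigma>)) = \<phi> \<Delta> (drop k \<sigma>)"
proof (cases "drop k \<sigma> = []")
  case False
  then have "drop k \<sigma> \<in> splx (m - int k)"
    using drop_ordered_simplices [OF complex assms(3)] by blast
  then show ?thesis
    using assms by (auto simp: drop_map ordered_simplices_def intro!: \<phi>_act)
qed (simp add: drop_map \<phi>_Nil)

lemma finite_support_drop:
  assumes "set \<Delta> \<subseteq> carrier G" "int (length \<Delta>) + m - int k = int n + 1"
  shows "finite {\<sigma> \<in> splx m. \<phi> \<Delta> (drop k \<sigma>) \<noteq> 0}"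
proof (rule finite_ordered_simplices_over [OF complex loc_fin])
  let ?T = "{\<tau> \<in> splx (m - int k). \<phi> \<Delta> \<tau> \<noteq> 0}"
  show "finite ?T" using assms by (intro \<phi>_finite) auto
  show "[] \<notin> ?T" by (simp add: \<phi>_Nil)
  fix \<sigma> assume \<sigma>: "\<sigma> \<in> {\<sigma> \<in> splx m. \<phi> \<Delta> (drop k \<sigma>) \<noteq> 0}"
  then have "drop k \<sigma> \<noteq> []" using \<phi>_Nil by auto
  then have "drop k \<sigma> \<in> ?T"
    using \<sigma> drop_ordered_simplices [OF complex] by auto
  then have "\<exists>\<tau>\<in>?T. set \<tau> \<subseteq> set \<sigma>"
    using set_drop_subset by (rule bexI [rotated])
  then show "\<sigma> \<in> splx m \<and> (\<exists>\<tau>\<in>?T. set \<tau> \<subseteq> set \<sigma>)" using \<sigma> by simp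
qed

text \<open>The degree is taken from the length of \<open>\<Delta>\<close>, so that one function
  covers all degrees and \<open>codiff\<close> applies to it.\<close>

definition slant_sum :: "(nat list \<Rightarrow> int) \<Rightarrow> 'a list \<Rightarrow> int" where
  "slant_sum z \<Delta> = (\<Sum>\<sigma>\<in>{\<sigma> \<in> splx (int n + 1 - int (length \<Delta>)). \<phi> \<Delta> \<sigma> \<noteq> 0}. \<phi> \<Delta> \<sigma> * z \<sigma>)"

lemma slant_sum_superset:
  assumes "finite A" "A \<subseteq> splx (int n + 1 - int (length \<Delta>))"
    "\<And>\<sigma>. \<sigma> \<in> splx (int n + 1 - int (length \<Delta>)) \<Longrightarrow> \<phi> \<Delta> \<sigma> \<noteq> 0 \<Longrightarrow> \<sigma> \<in> A"
  shows "slant_sum z \<Delta> = (\<Sum>\<sigma>\<in>A. \<phi> \<Delta> \<sigma> * z \<sigma>)"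
  unfolding slant_sum_def using assms by (intro sum.mono_neutral_left) auto

lemma slant_sum_act:
  assumes g: "g \<in> carrier G" and \<Delta>: "set \<Delta> \<subseteq> carrier G"
    and z: "\<And>\<sigma>. \<sigma> \<in> splx (int n + 1 - int (length \<Delta>)) \<Longrightarrow> z (map (\<psi> g) \<sigma>) = z \<sigma>"
  shows "slant_sum z (map ((\<otimes>) g) \<Delta>) = slant_sum z \<Delta>"
proof -
  let ?m = "int n + 1 - int (length \<Delta>)"
  have \<phi>: "\<phi> (map ((\<otimes>) g) \<Delta>) (map (\<psi> g) \<sigma>) = \<phi> \<Delta> \<sigma>" if "\<sigma> \<in> splx ?m" for \<sigma>
    using \<phi>_act_drop [OF g \<Delta> that, of 0] by simp
  have "bij_betw (map (\<psi> g)) {\<sigma> \<in> splx ?m. \<phi> \<Delta> \<sigma> \<noteq> 0}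
      {\<sigma> \<in> splx ?m. \<phi> (map ((\<otimes>) g) \<Delta>) \<sigma> \<noteq> 0}"
    by (rule bij_betw_Collect [OF bij_betw_splx [OF g]]) (simp add: \<phi>)
  then show ?thesis
    unfolding slant_sum_def length_map
    by (subst sum.reindex_bij_betw [symmetric]) (auto simp: \<phi> z intro!: sum.cong)
qed

text \<open>The boundary is moved onto \<open>\<phi> \<Delta>\<close> by \<open>sum_boundary\<close>
  and from there onto \<open>\<Delta>\<close> by the cocycle condition. This needs a finite set that
  serves \<open>\<Delta>\<close> and all its faces at once.\<close>

lemma slant_sum_boundary:
  assumes \<Delta>: "set \<Delta> \<subseteq> carrier G"
  shows "slant_sum (boundary K (int n + 2 - int (length \<Delta>)) y) \<Delta> =
           (-1) ^ length \<Delta> * codiff (slant_sum y) \<Delta>"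
proof -
  let ?m = "int n + 2 - int (length \<Delta>)"
  let ?A1 = "{\<sigma> \<in> splx ?m. \<exists>i<length \<sigma>. \<phi> \<Delta> (omit i \<sigma>) \<noteq> 0}"
  let ?A2 = "\<lambda>i. {\<sigma> \<in> splx ?m. \<phi> (omit i \<Delta>) \<sigma> \<noteq> 0}"
  define A where "A = ?A1 \<union> (\<Union>i<length \<Delta>. ?A2 i)"
  have len: "int n + 1 - int (length (omit i \<Delta>)) = ?m" if "i < length \<Delta>" for i
    using that by (simp add: length_omit of_nat_diff)
  have fin: "finite {\<tau> \<in> splx (?m - 1). \<phi> \<Delta> \<tau> \<noteq> 0}"
    by (rule \<phi>_finite [OF \<Delta>]) simp
  have "finite (?A2 i)" if "i < length \<Delta>" for i
    using \<Delta> set_omit_subset [of i \<Delta>] len [OF that] by (intro \<phi>_finite) auto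
  then have A: "finite A" "A \<subseteq> splx ?m"
    unfolding A_def using finite_omit_support [OF complex loc_fin \<phi>_Nil(1) fin] by auto
  have "slant_sum (boundary K ?m y) \<Delta> =
      (\<Sum>\<tau>\<in>{\<tau> \<in> splx (?m - 1). \<phi> \<Delta> \<tau> \<noteq> 0}. \<phi> \<Delta> \<tau> * boundary K ?m y \<tau>)"
    by (simp add: slant_sum_def algebra_simps)
  also have "\<dots> = (\<Sum>\<sigma>\<in>A. codiff (\<phi> \<Delta>) \<sigma> * y \<sigma>)"
    by (rule sum_boundary [OF complex loc_fin \<phi>_Nil(1) fin A]) (auto simp: A_def)
  also have "\<dots> = (\<Sum>\<sigma>\<in>A. (-1) ^ length \<Delta> * codiff (\<lambda>\<Delta>'. y \<sigma> * \<phi> \<Delta>' \<sigma>) \<Delta>)"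
  proof (rule sum.cong [OF refl])
    fix \<sigma> assume "\<sigma> \<in> A"
    then have "\<sigma> \<in> splx ?m" using A by blast
    then have "codiff (\<phi> \<Delta>) \<sigma> = (-1) ^ length \<Delta> * codiff (\<lambda>\<Delta>'. \<phi> \<Delta>' \<sigma>) \<Delta>"
      using \<Delta> by (intro \<phi>_codiff) (auto simp: ordered_simplices_def)
    then show "codiff (\<phi> \<Delta>) \<sigma> * y \<sigma> = (-1) ^ length \<Delta> * codiff (\<lambda>\<Delta>'. y \<sigma> * \<phi> \<Delta>' \<sigma>) \<Delta>"
      by (simp add: codiff_scale)
  qed
  also have "\<dots> = (-1) ^ length \<Delta> * codiff (\<lambda>\<Delta>'. \<Sum>\<sigma>\<in>A. y \<sigma> * \<phi> \<Delta>' \<sigma>) \<Delta>"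
    by (simp add: codiff_sum sum_distrib_left)
  also have "codiff (\<lambda>\<Delta>'. \<Sum>\<sigma>\<in>A. y \<sigma> * \<phi> \<Delta>' \<sigma>) \<Delta> = codiff (slant_sum y) \<Delta>"
  proof (rule codiff_cong)
    fix i assume i: "i < length \<Delta>"
    show "(\<Sum>\<sigma>\<in>A. y \<sigma> * \<phi> (omit i \<Delta>) \<sigma>) = slant_sum y (omit i \<Delta>)"
      unfolding mult.commute [of "y _"]
      by (rule slant_sum_superset [symmetric]) (use A i in \<open>auto simp: len A_def\<close>)
  qed
  finally show ?thesis .
qed

text \<open>The cap product sums over all simplices with back face \<open>\<tau>\<close>. The sign
  is that of \<open>transfer\<close>: without it, the operation on cochains would anticommute with
  \<open>codiff\<close>.\<close>

definition cap :: "(nat list \<Rightarrow> int) \<Rightarrow> ('a list \<Rightarrow> int) \<Rightarrow> nat \<Rightarrow> nat list \<Rightarrow> int" where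
  "cap z c k = (\<lambda>\<tau>\<in>splx (int n - int k).
     (-1) ^ k * (\<Sum>\<sigma>\<in>{\<sigma> \<in> splx (int n). drop k \<sigma> = \<tau>}. c (map f (take (Suc k) \<sigma>)) * z \<sigma>))"

text \<open>Adjunction of cap and cup: the simplices of dimension \<open>n\<close> are grouped by
  their back face.\<close>

lemma sum_cap:
  assumes F: "F [] = (0::int)" "finite {\<tau> \<in> splx (int n - int k). F \<tau> \<noteq> 0}"
  shows "(\<Sum>\<tau>\<in>{\<tau> \<in> splx (int n - int k). F \<tau> \<noteq> 0}. F \<tau> * cap z c k \<tau>) =
     (-1) ^ k * (\<Sum>\<sigma>\<in>{\<sigma> \<in> splx (int n). F (drop k \<sigma>) \<noteq> 0}.
       c (map f (take (Suc k) \<sigma>)) * F (drop k \<sigma>) * z \<sigma>)"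
    and "finite {\<sigma> \<in> splx (int n). F (drop k \<sigma>) \<noteq> 0}"
proof -
  let ?T = "{\<tau> \<in> splx (int n - int k). F \<tau> \<noteq> 0}"
  let ?A = "{\<sigma> \<in> splx (int n). F (drop k \<sigma>) \<noteq> 0}"
  let ?g = "\<lambda>\<sigma>. c (map f (take (Suc k) \<sigma>)) * F (drop k \<sigma>) * z \<sigma>"
  have dropT: "drop k \<sigma> \<in> ?T" if "\<sigma> \<in> ?A" for \<sigma>
  proof -
    have "drop k \<sigma> \<noteq> []" using that F(1) by (metis (mono_tags, lifting) mem_Collect_eq)
    then show ?thesis using that drop_ordered_simplices [OF complex] by auto
  qed
  show fin: "finite ?A"
  proof (rule finite_ordered_simplices_over [OF complex loc_fin F(2)])
    fix \<sigma> assume \<sigma>: "\<sigma> \<in> ?A"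
    have "\<exists>\<tau>\<in>?T. set \<tau> \<subseteq> set \<sigma>"
      using set_drop_subset dropT [OF \<sigma>] by (rule bexI)
    then show "\<sigma> \<in> splx (int n) \<and> (\<exists>\<tau>\<in>?T. set \<tau> \<subseteq> set \<sigma>)" using \<sigma> by simp
  qed (simp add: F)
  have "(\<Sum>\<tau>\<in>?T. F \<tau> * cap z c k \<tau>) = (\<Sum>\<tau>\<in>?T. (-1) ^ k * sum ?g {\<sigma> \<in> ?A. drop k \<sigma> = \<tau>})"
  proof (rule sum.cong [OF refl])
    fix \<tau> assume \<tau>: "\<tau> \<in> ?T"
    then have "{\<sigma> \<in> ?A. drop k \<sigma> = \<tau>} = {\<sigma> \<in> splx (int n). drop k \<sigma> = \<tau>}" by auto
    with \<tau> show "F \<tau> * cap z c k \<tau> = (-1) ^ k * sum ?g {\<sigma> \<in> ?A. drop k \<sigma> = \<tau>}"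
      by (simp add: cap_def sum_distrib_left mult_ac)
  qed
  also have "\<dots> = (-1) ^ k * sum ?g ?A"
    unfolding sum_distrib_left [symmetric] using fin dropT F(2) by (subst sum.group) auto
  finally show "(\<Sum>\<tau>\<in>?T. F \<tau> * cap z c k \<tau>) = (-1) ^ k * sum ?g ?A" .
qed

lemma cap_act:
  assumes g: "g \<in> carrier G" and \<tau>: "\<tau> \<in> splx (int n - int k)"
    and z: "\<And>\<sigma>. \<sigma> \<in> splx (int n) \<Longrightarrow> z (map (\<psi> g) \<sigma>) = z \<sigma>"
    and c: "\<And>p. set p \<subseteq> carrier G \<Longrightarrow> length p = Suc k \<Longrightarrow> c (map ((\<otimes>) g) p) = c p"
  shows "cap z c k (map (\<psi> g) \<tau>) = cap z c k \<tau>"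
proof -
  have g\<tau>: "map (\<psi> g) \<tau> \<in> splx (int n - int k)"
    using bij_betwE [OF bij_betw_splx [OF g]] \<tau> by blast
  have inj: "inj_on (map (\<psi> g)) (splx (int n - int k))"
    using bij_betw_splx [OF g] by (simp add: bij_betw_def)
  have ne: "\<tau> \<noteq> []" "map (\<psi> g) \<tau> \<noteq> []" using \<tau> ordered_simplices_nonempty [OF complex] by auto
  have bij: "bij_betw (map (\<psi> g)) {\<sigma> \<in> splx (int n). drop k \<sigma> = \<tau>}
      {\<sigma> \<in> splx (int n). drop k \<sigma> = map (\<psi> g) \<tau>}"
  proof (rule bij_betw_Collect [OF bij_betw_splx [OF g]])
    fix \<sigma> assume \<sigma>: "\<sigma> \<in> splx (int n)"
    show "drop k (map (\<psi> g) \<sigma>) = map (\<psi> g) \<tau> \<longleftrightarrow> drop k \<sigma> = \<tau>"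
    proof (cases "drop k \<sigma> = []")
      case False
      then show ?thesis
        using drop_ordered_simplices [OF complex \<sigma>] inj \<tau>
        by (simp add: drop_map inj_on_eq_iff del: map_eq_conv)
    qed (use ne in \<open>auto simp: drop_map\<close>)
  qed
  have c_eq: "c (map f (take (Suc k) (map (\<psi> g) \<sigma>))) = c (map f (take (Suc k) \<sigma>))"
    if "\<sigma> \<in> splx (int n)" "drop k \<sigma> = \<tau>" for \<sigma>
  proof -
    have "set (take (Suc k) \<sigma>) \<subseteq> \<Union>K"
      using that by (auto simp: ordered_simplices_def dest!: in_set_takeD)
    then have "map f (take (Suc k) (map (\<psi> g) \<sigma>)) = map ((\<otimes>) g) (map f (take (Suc k) \<sigma>))"
      unfolding take_map using f_map_act [OF g] by blast
    moreover have "length (take (Suc k) \<sigma>) = Suc k" using that ne by auto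
    ultimately show ?thesis
      using c [of "map f (take (Suc k) \<sigma>)"] f_map_closed [OF that(1), of "Suc k"]
      by (simp del: map_map)
  qed
  show ?thesis
    using \<tau> g\<tau> by (simp add: cap_def sum.reindex_bij_betw [OF bij, symmetric] c_eq z)
qed

text \<open>The value at \<open>\<tau>\<close> is the pairing with the indicator \<open>F\<close> of
  \<open>\<tau>\<close>. It moves to the pairing of the cap product with \<open>codiff F\<close>,
  then to that of \<open>z\<close> with the cup product of \<open>c\<close> and
  \<open>codiff F\<close>. As \<open>c\<close> is a cocycle, this cup product is up to sign the
  coboundary of \<open>U\<close>, which pairs to 0 with the cycle \<open>z\<close>.\<close>

lemma boundary_cap:
  assumes z: "\<And>\<tau>. \<tau> \<in> splx (int n - 1) \<Longrightarrow> boundary K (int n) z \<tau> = 0"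
    and c: "\<And>p. set p \<subseteq> carrier G \<Longrightarrow> length p = Suc (Suc k) \<Longrightarrow> codiff c p = 0"
    and \<tau>: "\<tau> \<in> splx (int n - int k - 1)"
  shows "boundary K (int n - int k) (cap z c k) \<tau> = 0"
proof -
  define F where "F = (\<lambda>\<rho>. if \<rho> = \<tau> then 1 else 0 :: int)"
  have ne: "\<tau> \<noteq> []" using \<tau> ordered_simplices_nonempty [OF complex] by auto
  then have F0: "F [] = 0" by (simp add: F_def)
  have supF: "{\<rho> \<in> splx (int n - int k - 1). F \<rho> \<noteq> 0} = {\<tau>}"
    using \<tau> by (auto simp: F_def)
  let ?A = "{\<rho> \<in> splx (int n - int k). \<exists>i<length \<rho>. F (omit i \<rho>) \<noteq> 0}"
  have finA: "finite ?A"
    by (rule finite_omit_support [where F = F, OF complex loc_fin F0]) (simp add: supF)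
  have cA: "\<rho> \<in> ?A" if "\<rho> \<in> splx (int n - int k)" "codiff F \<rho> \<noteq> 0" for \<rho>
    using that by (auto simp: codiff_def elim!: sum.not_neutral_contains_not_neutral)
  have fin: "finite {\<rho> \<in> splx (int n - int k). codiff F \<rho> \<noteq> 0}"
    by (rule finite_subset [OF _ finA]) (use cA in blast)
  have "boundary K (int n - int k) (cap z c k) \<tau> =
      (\<Sum>\<rho>\<in>{\<rho> \<in> splx (int n - int k - 1). F \<rho> \<noteq> 0}. F \<rho> * boundary K (int n - int k) (cap z c k) \<rho>)"
    unfolding supF by (simp add: F_def)
  also have "\<dots> = (\<Sum>\<rho>\<in>?A. codiff F \<rho> * cap z c k \<rho>)"
    by (rule sum_boundary [where F = F, OF complex loc_fin F0 _ finA]) (auto simp: supF)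
  also have "\<dots> = (\<Sum>\<rho>\<in>{\<rho> \<in> splx (int n - int k). codiff F \<rho> \<noteq> 0}. codiff F \<rho> * cap z c k \<rho>)"
    by (rule sum.mono_neutral_right [OF finA]) (use cA in auto)
  also have "\<dots> = (-1) ^ k * (\<Sum>\<sigma>\<in>{\<sigma> \<in> splx (int n). codiff F (drop k \<sigma>) \<noteq> 0}.
       c (map f (take (Suc k) \<sigma>)) * codiff F (drop k \<sigma>) * z \<sigma>)"
    by (rule sum_cap [OF _ fin]) simp
  also have "\<dots> = 0"
  proof -
    let ?B = "{\<sigma> \<in> splx (int n). codiff F (drop k \<sigma>) \<noteq> 0}"
    define U where "U = (\<lambda>p. c (map f (take (Suc k) p)) * F (drop k p))"
    have U0: "U [] = 0" by (simp add: U_def F0)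
    have cup: "codiff U \<sigma> = (-1) ^ k * c (map f (take (Suc k) \<sigma>)) * codiff F (drop k \<sigma>)"
      if "\<sigma> \<in> splx (int n)" for \<sigma>
    proof -
      \<comment> \<open>If the remaining back face is nonempty, the front face has exactly
        \<open>k + 2\<close> vertices, where \<open>c\<close> satisfies the cocycle condition;
        otherwise \<open>F [] = 0\<close> applies.\<close>
      have "codiff c (map f (take (Suc (Suc k)) \<sigma>)) * F (drop (Suc k) \<sigma>) = 0"
      proof (cases "drop (Suc k) \<sigma> = []")
        case False
        then show ?thesis using c f_map_closed [OF that, of "Suc (Suc k)"] by simp
      qed (simp add: F0)
      then show ?thesis
        unfolding U_def codiff_cup [where F = F and c = "\<lambda>p. c (map f p)", OF F0] codiff_map [symmetric] by simp
    qed
    have finU: "finite {\<sigma> \<in> splx (int n - 1). U \<sigma> \<noteq> 0}"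
      by (rule finite_ordered_simplices_over [OF complex loc_fin, of "{\<tau>}"])
        (use ne set_drop_subset in \<open>auto simp: U_def F_def dest: in_set_dropD split: if_splits\<close>)
    define A where "A = ?B \<union> {\<sigma> \<in> splx (int n). \<exists>i<length \<sigma>. U (omit i \<sigma>) \<noteq> 0}"
    have A: "finite A" "A \<subseteq> splx (int n)"
      unfolding A_def
      using sum_cap(2) [OF _ fin] finite_omit_support [where F = U, OF complex loc_fin U0 finU] by auto
    have "(\<Sum>\<sigma>\<in>?B. c (map f (take (Suc k) \<sigma>)) * codiff F (drop k \<sigma>) * z \<sigma>) =
        (\<Sum>\<sigma>\<in>A. c (map f (take (Suc k) \<sigma>)) * codiff F (drop k \<sigma>) * z \<sigma>)"
      by (rule sum.mono_neutral_left [OF A(1)]) (use A in \<open>auto simp: A_def\<close>)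
    also have "\<dots> = (\<Sum>\<sigma>\<in>A. (-1) ^ k * (codiff U \<sigma> * z \<sigma>))"
      by (rule sum.cong) (use A(2) in \<open>auto simp: cup simp flip: power_add mult.assoc\<close>)
    also have "\<dots> = (-1) ^ k * (\<Sum>\<tau>\<in>{\<tau> \<in> splx (int n - 1). U \<tau> \<noteq> 0}. U \<tau> * boundary K (int n) z \<tau>)"
      unfolding sum_distrib_left [symmetric]
      by (subst sum_boundary [where F = U, OF complex loc_fin U0 finU A]) (auto simp: A_def)
    also have "\<dots> = 0" using z by (simp add: sum.neutral)
    finally show ?thesis by simp
  qed
  finally show ?thesis .
qed

end

section \<open>The endomorphism of the bar cochains and its homotopy to the identity\<close>

context equivariant_slant
begin

text \<open>Precomposition with the chain map \<open>\<theta>\<close>, signs included; on the augmentation, which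
  is the value at the empty list, it is the identity.\<close>

definition transfer :: "(nat list \<Rightarrow> int) \<Rightarrow> ('a list \<Rightarrow> int) \<Rightarrow> 'a list \<Rightarrow> int" where
  "transfer z c \<Delta> = (if \<Delta> = [] then c [] else
     (-1) ^ (length \<Delta> - 1) *
     (\<Sum>\<sigma>\<in>{\<sigma> \<in> splx (int n). \<phi> \<Delta> (drop (length \<Delta> - 1) \<sigma>) \<noteq> 0}.
        c (map f (take (length \<Delta>) \<sigma>)) * \<phi> \<Delta> (drop (length \<Delta> - 1) \<sigma>) * z \<sigma>))"

lemma transfer_superset:
  assumes "length \<Delta> = Suc k" "finite A" "A \<subseteq> splx (int n)"
    "\<And>\<sigma>. \<sigma> \<in> splx (int n) \<Longrightarrow> \<phi> \<Delta> (drop k \<sigma>) \<noteq> 0 \<Longrightarrow> \<sigma> \<in> A"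
  shows "transfer z c \<Delta> =
    (-1) ^ k * (\<Sum>\<sigma>\<in>A. c (map f (take (Suc k) \<sigma>)) * \<phi> \<Delta> (drop k \<sigma>) * z \<sigma>)"
proof -
  have "(\<Sum>\<sigma>\<in>{\<sigma> \<in> splx (int n). \<phi> \<Delta> (drop k \<sigma>) \<noteq> 0}.
        c (map f (take (Suc k) \<sigma>)) * \<phi> \<Delta> (drop k \<sigma>) * z \<sigma>) =
      (\<Sum>\<sigma>\<in>A. c (map f (take (Suc k) \<sigma>)) * \<phi> \<Delta> (drop k \<sigma>) * z \<sigma>)"
    using assms by (intro sum.mono_neutral_left) auto
  then show ?thesis using assms(1) by (auto simp: transfer_def)
qed

lemma transfer_diff: "transfer z (\<lambda>p. c p - d p) \<Delta> = transfer z c \<Delta> - transfer z d \<Delta>"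
  by (simp add: transfer_def algebra_simps sum_subtractf)

lemma transfer_cong:
  assumes "\<And>p. length p = length \<Delta> \<Longrightarrow> set p \<subseteq> carrier G \<Longrightarrow> c p = d p"
  shows "transfer z c \<Delta> = transfer z d \<Delta>"
proof (cases "\<Delta> = []")
  case True
  then show ?thesis using assms by (simp add: transfer_def)
next
  case False
  have "c (map f (take (length \<Delta>) \<sigma>)) = d (map f (take (length \<Delta>) \<sigma>))"
    if "\<sigma> \<in> splx (int n)" "\<phi> \<Delta> (drop (length \<Delta> - 1) \<sigma>) \<noteq> 0" for \<sigma>
  proof -
    \<comment> \<open>A nonempty back face means that the front face has its full length.\<close>
    have "drop (length \<Delta> - 1) \<sigma> \<noteq> []" using that \<phi>_Nil by auto
    then show ?thesis using assms f_map_closed [OF that(1)] False by simp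
  qed
  then show ?thesis using False by (simp add: transfer_def)
qed

lemma transfer_act:
  assumes g: "g \<in> carrier G" and \<Delta>: "set \<Delta> \<subseteq> carrier G"
    and z: "\<And>\<sigma>. \<sigma> \<in> splx (int n) \<Longrightarrow> z (map (\<psi> g) \<sigma>) = z \<sigma>"
  shows "transfer z c (map ((\<otimes>) g) \<Delta>) = transfer z (\<lambda>p. c (map ((\<otimes>) g) p)) \<Delta>"
proof (cases "\<Delta> = []")
  case False
  let ?k = "length \<Delta> - 1"
  have \<phi>: "\<phi> (map ((\<otimes>) g) \<Delta>) (drop ?k (map (\<psi> g) \<sigma>)) = \<phi> \<Delta> (drop ?k \<sigma>)"
    if "\<sigma> \<in> splx (int n)" for \<sigma>
    using False by (intro \<phi>_act_drop [OF g \<Delta> that]) (auto simp: of_nat_diff Suc_le_eq)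
  have bij: "bij_betw (map (\<psi> g)) {\<sigma> \<in> splx (int n). \<phi> \<Delta> (drop ?k \<sigma>) \<noteq> 0}
      {\<sigma> \<in> splx (int n). \<phi> (map ((\<otimes>) g) \<Delta>) (drop ?k \<sigma>) \<noteq> 0}"
    by (rule bij_betw_Collect [OF bij_betw_splx [OF g]]) (simp only: \<phi>)
  have f: "map f (take j (map (\<psi> g) \<sigma>)) = map ((\<otimes>) g) (map f (take j \<sigma>))"
    if "\<sigma> \<in> splx (int n)" for \<sigma> j
    unfolding take_map using that
    by (intro f_map_act [OF g]) (auto simp: ordered_simplices_def dest!: in_set_takeD)
  have "(\<Sum>\<sigma>\<in>{\<sigma> \<in> splx (int n). \<phi> (map ((\<otimes>) g) \<Delta>) (drop ?k \<sigma>) \<noteq> 0}.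
      c (map f (take (length \<Delta>) \<sigma>)) * \<phi> (map ((\<otimes>) g) \<Delta>) (drop ?k \<sigma>) * z \<sigma>) =
    (\<Sum>\<sigma>\<in>{\<sigma> \<in> splx (int n). \<phi> \<Delta> (drop ?k \<sigma>) \<noteq> 0}.
      c (map ((\<otimes>) g) (map f (take (length \<Delta>) \<sigma>))) * \<phi> \<Delta> (drop ?k \<sigma>) * z \<sigma>)"
    unfolding sum.reindex_bij_betw [OF bij, symmetric]
    by (intro sum.cong refl) (simp only: mem_Collect_eq \<phi> f z)
  then show ?thesis using False by (simp add: transfer_def)
qed (simp add: transfer_def)

text \<open>In degree 0 this is the normalization of \<open>z\<close>. In higher degrees the cycle
  \<open>z\<close> pairs to 0 with the coboundary of the cup product of \<open>c\<close> and
  \<open>\<phi> \<Delta>\<close>; the Leibniz rule and the cocycle condition on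
  \<open>\<phi>\<close> split this pairing into the two sides.\<close>

lemma transfer_codiff:
  assumes z: "\<And>\<tau>. \<tau> \<in> splx (int n - 1) \<Longrightarrow> boundary K (int n) z \<tau> = 0"
    and unit: "\<And>g. g \<in> carrier G \<Longrightarrow> slant_sum z [g] = 1"
    and \<Delta>: "set \<Delta> \<subseteq> carrier G"
  shows "transfer z (codiff c) \<Delta> = codiff (transfer z c) \<Delta>"
proof -
  consider "\<Delta> = []" | g where "\<Delta> = [g]" | k where "length \<Delta> = Suc (Suc k)"
    by (metis One_nat_def length_0_conv length_Suc_conv not0_implies_Suc)
  then show ?thesis
  proof cases
    case 1
    then show ?thesis by (simp add: transfer_def)
  next
    case 2
    \<comment> \<open>At a single vertex the augmented coboundary is the value at the empty list, so
      the sum collapses to \<open>c []\<close> times the slant product, which is 1.\<close>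
    have "codiff c (map f (take 1 \<sigma>)) = c []" if "\<sigma> \<in> splx (int n)" for \<sigma>
      using that by (cases \<sigma>) (auto simp: ordered_simplices_def codiff_Cons)
    then have "transfer z (codiff c) \<Delta> = c [] * slant_sum z [g]"
      by (simp add: transfer_def 2 slant_sum_def sum_distrib_left mult.assoc)
    then show ?thesis using 2 \<Delta> by (simp add: unit transfer_def codiff_Cons)
  next
    case (3 k)
    \<comment> \<open>A cochain of degree \<open>n - 1\<close>: \<open>c\<close> is read in degree
      \<open>k\<close> and \<open>\<phi> \<Delta>\<close> in degree \<open>n - k - 1\<close>, since
      \<open>\<Delta>\<close> has dimension \<open>k + 1\<close>.\<close>
    define U where "U = (\<lambda>p. c (map f (take (Suc k) p)) * \<phi> \<Delta> (drop k p))"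
    have U0: "U [] = 0" by (simp add: U_def \<phi>_Nil)
    have finU: "finite {\<tau> \<in> splx (int n - 1). U \<tau> \<noteq> 0}"
      by (rule finite_subset [OF _ finite_support_drop [OF \<Delta>, of "int n - 1" k]])
        (use 3 in \<open>auto simp: U_def\<close>)
    let ?A1 = "{\<sigma> \<in> splx (int n). \<exists>i<length \<sigma>. U (omit i \<sigma>) \<noteq> 0}"
    let ?A2 = "{\<sigma> \<in> splx (int n). \<phi> \<Delta> (drop (Suc k) \<sigma>) \<noteq> 0}"
    let ?A3 = "\<lambda>i. {\<sigma> \<in> splx (int n). \<phi> (omit i \<Delta>) (drop k \<sigma>) \<noteq> 0}"
    define A where "A = ?A1 \<union> ?A2 \<union> (\<Union>i<length \<Delta>. ?A3 i)"
    have "finite ?A1" by (rule finite_omit_support [where F = U, OF complex loc_fin U0 finU])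
    moreover have "finite ?A2" using 3 by (intro finite_support_drop [OF \<Delta>]) auto
    moreover have "finite (?A3 i)" if "i < length \<Delta>" for i
      using \<Delta> set_omit_subset [of i \<Delta>] that 3
      by (intro finite_support_drop) (auto simp: length_omit)
    ultimately have A: "finite A" "A \<subseteq> splx (int n)" by (auto simp: A_def)
    have cup: "codiff U \<sigma> = codiff c (map f (take (Suc (Suc k)) \<sigma>)) * \<phi> \<Delta> (drop (Suc k) \<sigma>)
        + c (map f (take (Suc k) \<sigma>)) * codiff (\<lambda>\<Delta>'. \<phi> \<Delta>' (drop k \<sigma>)) \<Delta>" if "\<sigma> \<in> A" for \<sigma>
    proof -
      \<comment> \<open>Since \<open>length \<Delta> = k + 2\<close>, the sign of the cocycle
        condition is \<open>(-1) ^ k\<close>, as in the Leibniz rule, and the two cancel.\<close>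
      have "codiff (\<phi> \<Delta>) (drop k \<sigma>) = (-1) ^ k * codiff (\<lambda>\<Delta>'. \<phi> \<Delta>' (drop k \<sigma>)) \<Delta>"
      proof (cases "drop k \<sigma> = []")
        case False
        then have "drop k \<sigma> \<in> splx (int n - int k)"
          using that A drop_ordered_simplices [OF complex] by blast
        then show ?thesis
          using \<phi>_codiff [OF \<Delta>, of "drop k \<sigma>"] 3 by (auto simp: ordered_simplices_def)
      qed (simp add: \<phi>_Nil)
      then have *: "(-1) ^ k * x * codiff (\<phi> \<Delta>) (drop k \<sigma>) =
          x * codiff (\<lambda>\<Delta>'. \<phi> \<Delta>' (drop k \<sigma>)) \<Delta>" for x
        by (simp add: mult_ac flip: power_add)
      show ?thesis
        unfolding U_def
          codiff_cup [where F = "\<phi> \<Delta>" and c = "\<lambda>p. c (map f p)", OF \<phi>_Nil(1)]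
          codiff_map [symmetric] by (simp only: *)
    qed
    have "0 = (\<Sum>\<tau>\<in>{\<tau> \<in> splx (int n - 1). U \<tau> \<noteq> 0}. U \<tau> * boundary K (int n) z \<tau>)"
      using z by (simp add: sum.neutral)
    also have "\<dots> = (\<Sum>\<sigma>\<in>A. codiff U \<sigma> * z \<sigma>)"
      by (rule sum_boundary [where F = U, OF complex loc_fin U0 finU A]) (auto simp: A_def)
    also have "\<dots> = (\<Sum>\<sigma>\<in>A. codiff c (map f (take (Suc (Suc k)) \<sigma>)) * \<phi> \<Delta> (drop (Suc k) \<sigma>) * z \<sigma>)
      + (\<Sum>\<sigma>\<in>A. codiff (\<lambda>\<Delta>'. c (map f (take (Suc k) \<sigma>)) * z \<sigma> * \<phi> \<Delta>' (drop k \<sigma>)) \<Delta>)"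
      unfolding codiff_scale by (simp add: cup algebra_simps flip: sum.distrib)
    also have "(\<Sum>\<sigma>\<in>A. codiff c (map f (take (Suc (Suc k)) \<sigma>)) * \<phi> \<Delta> (drop (Suc k) \<sigma>) * z \<sigma>) =
        (-1) ^ Suc k * transfer z (codiff c) \<Delta>"
      using transfer_superset [OF 3 A, of z "codiff c"]
      by (auto simp: A_def simp flip: power_add mult.assoc)
    also have "(\<Sum>\<sigma>\<in>A. codiff (\<lambda>\<Delta>'. c (map f (take (Suc k) \<sigma>)) * z \<sigma> * \<phi> \<Delta>' (drop k \<sigma>)) \<Delta>) =
        codiff (\<lambda>\<Delta>'. (-1) ^ k * transfer z c \<Delta>') \<Delta>"
      unfolding codiff_sum [symmetric]
    proof (rule codiff_cong)
      fix i assume i: "i < length \<Delta>"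
      have "transfer z c (omit i \<Delta>) =
          (-1) ^ k * (\<Sum>\<sigma>\<in>A. c (map f (take (Suc k) \<sigma>)) * \<phi> (omit i \<Delta>) (drop k \<sigma>) * z \<sigma>)"
        by (rule transfer_superset [OF _ A]) (use 3 i in \<open>auto simp: length_omit A_def\<close>)
      then show "(\<Sum>\<sigma>\<in>A. c (map f (take (Suc k) \<sigma>)) * z \<sigma> * \<phi> (omit i \<Delta>) (drop k \<sigma>)) =
          (-1) ^ k * transfer z c (omit i \<Delta>)"
        by (simp add: mult_ac flip: power_add)
    qed
    \<comment> \<open>\<open>transfer\<close> has sign \<open>(-1) ^ Suc k\<close> at
      \<open>\<Delta>\<close> and \<open>(-1) ^ k\<close> at its faces; so the vanishing sum becomes
      a vanishing difference.\<close>
    finally have "(-1) ^ k * (codiff (transfer z c) \<Delta> - transfer z (codiff c) \<Delta>) = 0"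
      by (simp add: codiff_scale algebra_simps)
    then show ?thesis by simp
  qed
qed

lemma slant_sum_cap:
  assumes "set \<Delta> \<subseteq> carrier G" "length \<Delta> = Suc k"
  shows "slant_sum (cap z c k) \<Delta> = transfer z c \<Delta>"
proof -
  have eq: "int n + 1 - int (length \<Delta>) = int n - int k" using assms(2) by simp
  have "finite {\<tau> \<in> splx (int n - int k). \<phi> \<Delta> \<tau> \<noteq> 0}"
    using assms by (intro \<phi>_finite) auto
  from sum_cap(1) [where F = "\<phi> \<Delta>", OF \<phi>_Nil(1) this] show ?thesis
    using assms(2) by (auto simp: slant_sum_def eq transfer_def)
qed

lemma cone_homotopy_transfer_cong:
  assumes "set \<Delta> \<subseteq> carrier G"
    and "\<And>p. length p = Suc (length \<Delta>) \<Longrightarrow> set p \<subseteq> carrier G \<Longrightarrow> c p = d p"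
  shows "cone_homotopy (transfer z) c \<Delta> = cone_homotopy (transfer z) d \<Delta>"
proof (rule cone_homotopy_cong [where V = "carrier G"])
  fix c d :: "'a list \<Rightarrow> int" and xs :: "'a list"
  assume "\<And>p. length p = length xs \<Longrightarrow> set p \<subseteq> carrier G \<Longrightarrow> c p = d p"
  then show "transfer z c xs = transfer z d xs" by (rule transfer_cong)
qed (fact assms)+

lemma transfer_homotopic_id:
  assumes z: "\<And>\<tau>. \<tau> \<in> splx (int n - 1) \<Longrightarrow> boundary K (int n) z \<tau> = 0"
    and unit: "\<And>g. g \<in> carrier G \<Longrightarrow> slant_sum z [g] = 1"
    and c: "\<And>p. set p \<subseteq> carrier G \<Longrightarrow> length p = Suc (length \<Delta>) \<Longrightarrow> codiff c p = 0"
    and \<Delta>: "set \<Delta> \<subseteq> carrier G"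
  shows "transfer z c \<Delta> = c \<Delta> + codiff (cone_homotopy (transfer z) c) \<Delta>"
proof -
  \<comment> \<open>The cocycle condition is available only on lists over the group and in one
    degree, so \<open>codiff c\<close> is first replaced by the zero function there; linearity then
    gives 0.\<close>
  have "cone_homotopy (transfer z) (codiff c) \<Delta> = cone_homotopy (transfer z) (\<lambda>_. 0) \<Delta>"
    by (rule cone_homotopy_transfer_cong [OF \<Delta>]) (simp add: c)
  also have "\<dots> = 0"
    using cone_homotopy_diff [where T = "transfer z" and c = c and d = c] transfer_diff by simp
  finally show ?thesis
    using cone_homotopy_codiff [where T = "transfer z" and V = "carrier G", OF transfer_diff _ _ \<Delta>, of c]
      transfer_codiff [OF z unit]
    by (simp add: transfer_def)
qed

lemma cone_homotopy_transfer_act: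
  assumes g: "g \<in> carrier G" and \<Delta>: "set \<Delta> \<subseteq> carrier G"
    and z: "\<And>\<sigma>. \<sigma> \<in> splx (int n) \<Longrightarrow> z (map (\<psi> g) \<sigma>) = z \<sigma>"
    and c: "\<And>p. set p \<subseteq> carrier G \<Longrightarrow> length p = Suc (length \<Delta>) \<Longrightarrow> c (map ((\<otimes>) g) p) = c p"
  shows "cone_homotopy (transfer z) c (map ((\<otimes>) g) \<Delta>) = cone_homotopy (transfer z) c \<Delta>"
proof -
  have "cone_homotopy (transfer z) c (map ((\<otimes>) g) \<Delta>) =
      cone_homotopy (transfer z) (\<lambda>p. c (map ((\<otimes>) g) p)) \<Delta>"
    using \<Delta> by (rule cone_homotopy_map [rotated]) (use transfer_act g z in blast)
  also have "\<dots> = cone_homotopy (transfer z) c \<Delta>"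
    by (rule cone_homotopy_transfer_cong [OF \<Delta>]) (simp add: c)
  finally show ?thesis .
qed

end

section \<open>Cohomology classes\<close>

lemma carrier_invariant_functions:
  "u \<in> carrier (invariant_functions G A \<theta>) \<longleftrightarrow>
     u \<in> extensional A \<and> (\<forall>g\<in>carrier G. \<forall>x\<in>A. u (\<theta> g x) = u x)"
  by (simp add: invariant_functions_def PiE_def)

lemma mult_invariant_functions:
  "u \<otimes>\<^bsub>invariant_functions G A \<theta>\<^esub> v = (\<lambda>x\<in>A. u x + v x)"
  by (simp add: invariant_functions_def)

lemma one_invariant_functions: "\<one>\<^bsub>invariant_functions G A \<theta>\<^esub> = (\<lambda>x\<in>A. 0)"
  by (simp add: invariant_functions_def)

lemma group_tuples_iff: "\<Delta> \<in> group_tuples G k \<longleftrightarrow> length \<Delta> = Suc k \<and> set \<Delta> \<subseteq> carrier G"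
  by (simp add: group_tuples_def)

lemma omit_group_tuples:
  "\<Delta> \<in> group_tuples G (Suc k) \<Longrightarrow> i < length \<Delta> \<Longrightarrow> omit i \<Delta> \<in> group_tuples G k"
  using set_omit_subset [of i \<Delta>] by (auto simp: group_tuples_iff length_omit)

lemma coboundary_eq_codiff: "coboundary G k u = (\<lambda>\<Delta>\<in>group_tuples G (Suc k). codiff u \<Delta>)"
  by (auto simp: coboundary_def codiff_def group_tuples_iff lessThan_Suc_atMost)

lemma (in group) map_group_tuples:
  "g \<in> carrier G \<Longrightarrow> \<Delta> \<in> group_tuples G k \<Longrightarrow> map ((\<otimes>) g) \<Delta> \<in> group_tuples G k"
  by (auto simp: group_tuples_iff)

lemma (in group) restrict_cochain_group:
  assumes "\<And>g \<Delta>. g \<in> carrier G \<Longrightarrow> \<Delta> \<in> group_tuples G k \<Longrightarrow> u (map ((\<otimes>) g) \<Delta>) = u \<Delta>"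
  shows "restrict u (group_tuples G k) \<in> carrier (cochain_group G k)"
  using assms map_group_tuples by (simp add: cochain_group_def carrier_invariant_functions)

text \<open>For \<open>k = 0\<close> the only coboundary is 0, while \<open>codiff u\<close> on a
  list of length one is \<open>u []\<close>; this is where \<open>u [] = 0\<close> enters.\<close>

lemma (in group) codiff_in_coboundaries:
  assumes u: "\<And>g \<Delta>. g \<in> carrier G \<Longrightarrow> set \<Delta> \<subseteq> carrier G \<Longrightarrow> length \<Delta> = k \<Longrightarrow>
      u (map ((\<otimes>) g) \<Delta>) = u \<Delta>"
    and "u [] = 0"
  shows "(\<lambda>\<Delta>\<in>group_tuples G k. codiff u \<Delta>) \<in> coboundaries G k"
proof (cases k)
  case 0
  have "codiff u \<Delta> = 0" if "\<Delta> \<in> group_tuples G 0" for \<Delta>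
    using that \<open>u [] = 0\<close> by (auto simp: group_tuples_iff length_Suc_conv codiff_Cons)
  then show ?thesis
    using 0 by (auto simp: coboundaries_def cochain_group_def one_invariant_functions)
next
  case (Suc j)
  let ?u = "restrict u (group_tuples G j)"
  have "codiff u \<Delta> = codiff ?u \<Delta>" if "\<Delta> \<in> group_tuples G k" for \<Delta>
    using that Suc by (intro codiff_cong) (simp add: omit_group_tuples)
  then have "(\<lambda>\<Delta>\<in>group_tuples G k. codiff u \<Delta>) = coboundary G j ?u"
    using Suc by (auto simp: coboundary_eq_codiff)
  moreover have "?u \<in> carrier (cochain_group G j)"
    using u Suc by (intro restrict_cochain_group) (simp add: group_tuples_iff)
  ultimately show ?thesis using Suc by (simp add: coboundaries_def)
qed

text \<open>The scalars 1 and -1 give the two inclusions between cosets in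
  \<open>cohomology_class_cong\<close>.\<close>

lemma (in group) coboundaries_add_scaled:
  assumes "b \<in> coboundaries G k" "b' \<in> coboundaries G k"
  shows "(\<lambda>\<Delta>\<in>group_tuples G k. b \<Delta> + a * b' \<Delta>) \<in> coboundaries G k"
proof (cases k)
  case 0
  then show ?thesis
    using assms by (auto simp: coboundaries_def cochain_group_def one_invariant_functions)
next
  case (Suc j)
  with assms obtain u u' where u: "u \<in> carrier (cochain_group G j)" "b = coboundary G j u"
    and u': "u' \<in> carrier (cochain_group G j)" "b' = coboundary G j u'"
    by (auto simp: coboundaries_def)
  let ?v = "\<lambda>\<Delta>. u \<Delta> + a * u' \<Delta>"
  have "codiff ?v \<Delta> = b \<Delta> + a * b' \<Delta>" if "\<Delta> \<in> group_tuples G k" for \<Delta>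
    unfolding codiff_add codiff_scale using that Suc by (simp add: u u' coboundary_eq_codiff)
  moreover have "codiff ?v \<Delta> = codiff (restrict ?v (group_tuples G j)) \<Delta>"
    if "\<Delta> \<in> group_tuples G k" for \<Delta>
    using that Suc by (intro codiff_cong) (simp add: omit_group_tuples)
  ultimately have "(\<lambda>\<Delta>\<in>group_tuples G k. b \<Delta> + a * b' \<Delta>) =
      coboundary G j (restrict ?v (group_tuples G j))"
    using Suc by (auto simp: coboundary_eq_codiff)
  moreover have "restrict ?v (group_tuples G j) \<in> carrier (cochain_group G j)"
    using u(1) u'(1)
    by (intro restrict_cochain_group) (simp add: cochain_group_def carrier_invariant_functions)
  ultimately show ?thesis using Suc by (simp add: coboundaries_def)
qed

lemma cohomology_class_eq:
  "cohomology_class G k s = (\<lambda>b. \<lambda>\<Delta>\<in>group_tuples G k. b \<Delta> + s \<Delta>) ` coboundaries G k"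
  by (auto simp: cohomology_class_def r_coset_def cocycle_group_def cochain_group_def
      mult_invariant_functions)

lemma (in group) cohomology_class_cong:
  assumes b: "b \<in> coboundaries G k"
    and s: "\<And>\<Delta>. \<Delta> \<in> group_tuples G k \<Longrightarrow> s' \<Delta> = b \<Delta> + s \<Delta>"
  shows "cohomology_class G k s' = cohomology_class G k s"
proof (intro equalityI subsetI)
  fix x assume "x \<in> cohomology_class G k s'"
  then obtain b' where b': "b' \<in> coboundaries G k" "x = (\<lambda>\<Delta>\<in>group_tuples G k. b' \<Delta> + s' \<Delta>)"
    by (auto simp: cohomology_class_eq)
  let ?b = "\<lambda>\<Delta>\<in>group_tuples G k. b' \<Delta> + 1 * b \<Delta>"
  have "x = (\<lambda>\<Delta>\<in>group_tuples G k. ?b \<Delta> + s \<Delta>)"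
    using b'(2) s by auto
  then show "x \<in> cohomology_class G k s"
    unfolding cohomology_class_eq using coboundaries_add_scaled [OF b'(1) b] by blast
next
  fix x assume "x \<in> cohomology_class G k s"
  then obtain b' where b': "b' \<in> coboundaries G k" "x = (\<lambda>\<Delta>\<in>group_tuples G k. b' \<Delta> + s \<Delta>)"
    by (auto simp: cohomology_class_eq)
  let ?b = "\<lambda>\<Delta>\<in>group_tuples G k. b' \<Delta> + (-1) * b \<Delta>"
  have "x = (\<lambda>\<Delta>\<in>group_tuples G k. ?b \<Delta> + s' \<Delta>)"
    using b'(2) s by auto
  then show "x \<in> cohomology_class G k s'"
    unfolding cohomology_class_eq using coboundaries_add_scaled [OF b'(1) b] by blast
qed

lemma group_cohomology_cases:
  assumes "C \<in> carrier (group_cohomology G k)"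
  obtains c where "C = cohomology_class G k c"
    "\<And>g \<Delta>. g \<in> carrier G \<Longrightarrow> \<Delta> \<in> group_tuples G k \<Longrightarrow> c (map ((\<otimes>\<^bsub>G\<^esub>) g) \<Delta>) = c \<Delta>"
    "\<And>\<Delta>. \<Delta> \<in> group_tuples G (Suc k) \<Longrightarrow> codiff c \<Delta> = 0"
proof -
  obtain c where "c \<in> kernel (cochain_group G k) (cochain_group G (Suc k)) (coboundary G k)"
    and C: "C = cohomology_class G k c"
    using assms
    by (auto simp: group_cohomology_def FactGroup_def RCOSETS_def cohomology_class_def cocycle_group_def)
  then have "c \<in> carrier (cochain_group G k)" "coboundary G k c = (\<lambda>\<Delta>\<in>group_tuples G (Suc k). 0)"
    by (auto simp: kernel_def cochain_group_def one_invariant_functions)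
  moreover from this(2) have "codiff c \<Delta> = 0" if "\<Delta> \<in> group_tuples G (Suc k)" for \<Delta>
    using that by (metis coboundary_eq_codiff restrict_apply')
  ultimately show thesis
    using C that by (auto simp: cochain_group_def carrier_invariant_functions)
qed

lemma equivariant_homology_eq:
  "carrier (equivariant_homology G K \<psi> m) =
     (\<lambda>z. (\<lambda>y. \<lambda>\<sigma>\<in>ordered_simplices K m. boundary K (m + 1) y \<sigma> + z \<sigma>) `
        carrier (chain_group G K \<psi> (m + 1))) `
     {z \<in> carrier (chain_group G K \<psi> m). \<forall>\<tau>\<in>ordered_simplices K (m - 1). boundary K m z \<tau> = 0}"
proof -
  have "kernel (chain_group G K \<psi> m) (chain_group G K \<psi> (m - 1)) (boundary K m) =
     {z \<in> carrier (chain_group G K \<psi> m). \<forall>\<tau>\<in>ordered_simplices K (m - 1). boundary K m z \<tau> = 0}"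
    by (auto simp: kernel_def chain_group_def one_invariant_functions boundary_def
        fun_eq_iff restrict_def)
  then show ?thesis
    by (auto simp: equivariant_homology_def FactGroup_def RCOSETS_def r_coset_def
        chain_group_def mult_invariant_functions image_UN)
qed

section \<open>From chains and cochains to classes\<close>

context equivariant_slant
begin

context
  fixes \<alpha> \<omega>
  assumes slant: "\<And>k z. slant G n K \<alpha> \<omega> k z = (\<lambda>\<Delta>\<in>group_tuples G k. slant_sum z \<Delta>)"
begin

lemma chain_act:
  assumes "z \<in> carrier (chain_group G K \<psi> m)" "g \<in> carrier G" "\<sigma> \<in> splx m"
  shows "z (map (\<psi> g) \<sigma>) = z \<sigma>"
  using assms by (simp add: chain_group_def carrier_invariant_functions)

text \<open>The slant product is well defined on homology classes: by
  \<open>slant_sum_boundary\<close>, a boundary changes it by a coboundary.\<close>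

lemma cohomology_class_slant_boundary:
  assumes y: "y \<in> carrier (chain_group G K \<psi> (int n - int k + 1))"
  shows "cohomology_class G k (slant G n K \<alpha> \<omega> k
      (\<lambda>\<sigma>\<in>splx (int n - int k). boundary K (int n - int k + 1) y \<sigma> + z \<sigma>)) =
    cohomology_class G k (slant G n K \<alpha> \<omega> k z)"
proof (rule cohomology_class_cong)
  \<comment> \<open>The exponent is the length of the tuples \<open>\<Delta>\<close> of degree
    \<open>k\<close>, as in \<open>slant_sum_boundary\<close>.\<close>
  let ?u = "\<lambda>\<Delta>. (-1) ^ Suc k * slant_sum y \<Delta>"
  have "slant_sum y (map ((\<otimes>) g) \<Delta>) = slant_sum y \<Delta>"
    if "g \<in> carrier G" "set \<Delta> \<subseteq> carrier G" "length \<Delta> = k" for g \<Delta>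
    using that chain_act [OF y] by (intro slant_sum_act) (auto simp: algebra_simps)
  then show "(\<lambda>\<Delta>\<in>group_tuples G k. codiff ?u \<Delta>) \<in> coboundaries G k"
    by (intro codiff_in_coboundaries) (auto simp: slant_sum_def \<phi>_Nil)
  fix \<Delta> assume \<Delta>: "\<Delta> \<in> group_tuples G k"
  then have "int n - int k + 1 = int n + 2 - int (length \<Delta>)" "set \<Delta> \<subseteq> carrier G"
    and m: "int n - int k = int n + 1 - int (length \<Delta>)"
    by (auto simp: group_tuples_iff)
  with slant_sum_boundary [of \<Delta> y]
  have "codiff ?u \<Delta> = slant_sum (boundary K (int n - int k + 1) y) \<Delta>"
    using \<Delta> by (simp only: codiff_scale group_tuples_iff)
  then show "slant G n K \<alpha> \<omega> k
      (\<lambda>\<sigma>\<in>splx (int n - int k). boundary K (int n - int k + 1) y \<sigma> + z \<sigma>) \<Delta> =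
      (\<lambda>\<Delta>\<in>group_tuples G k. codiff ?u \<Delta>) \<Delta> + slant G n K \<alpha> \<omega> k z \<Delta>"
    using \<Delta> by (simp add: slant slant_sum_def flip: m) (simp add: distrib_left sum.distrib)
qed

lemma alpha_cap_coset:
  "alpha_cap G n K \<alpha> \<omega> k ((\<lambda>y. \<lambda>\<sigma>\<in>splx (int n - int k). boundary K (int n - int k + 1) y \<sigma> + z \<sigma>) `
        carrier (chain_group G K \<psi> (int n - int k + 1))) =
     cohomology_class G k (slant G n K \<alpha> \<omega> k z)"
proof -
  let ?Y = "carrier (chain_group G K \<psi> (int n - int k + 1))"
  \<comment> \<open>The zero chain shows that the coset is nonempty; its image is then a genuine
    singleton, as \<open>the_elem\<close> requires.\<close>
  have "(\<lambda>\<sigma>\<in>splx (int n - int k + 1). 0) \<in> ?Y"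
    using bij_betwE [OF bij_betw_splx]
    by (auto simp: chain_group_def carrier_invariant_functions)
  then have "?Y \<noteq> {}" by blast
  then have "(\<lambda>z. cohomology_class G k (slant G n K \<alpha> \<omega> k z)) `
      ((\<lambda>y. \<lambda>\<sigma>\<in>splx (int n - int k). boundary K (int n - int k + 1) y \<sigma> + z \<sigma>) ` ?Y) =
      {cohomology_class G k (slant G n K \<alpha> \<omega> k z)}"
    unfolding image_image by (auto simp: cohomology_class_slant_boundary)
  then show ?thesis by (simp add: alpha_cap_def)
qed

lemma alpha_cap_surj:
  assumes unit: "cohomology_unit G \<in> alpha_cap G n K \<alpha> \<omega> 0 ` carrier (equivariant_homology G K \<psi> (int n))"
    and C: "C \<in> carrier (group_cohomology G k)"
  shows "C \<in> alpha_cap G n K \<alpha> \<omega> k ` carrier (equivariant_homology G K \<psi> (int n - int k))"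
proof -
  obtain z where z: "z \<in> carrier (chain_group G K \<psi> (int n))"
      "\<And>\<tau>. \<tau> \<in> splx (int n - 1) \<Longrightarrow> boundary K (int n) z \<tau> = 0"
    and z_unit: "cohomology_unit G = cohomology_class G 0 (slant G n K \<alpha> \<omega> 0 z)"
    using unit alpha_cap_coset [of 0] by (auto simp: equivariant_homology_eq)
  \<comment> \<open>Degree 0 has no coboundary except 0, so equality of classes is equality of
    functions, and the slant product is 1 at every group element.\<close>
  have z1: "slant_sum z [g] = 1" if "g \<in> carrier G" for g
  proof -
    have "[g] \<in> group_tuples G 0" using that by (simp add: group_tuples_iff)
    moreover have "(\<lambda>\<Delta>\<in>group_tuples G 0. 1) = (\<lambda>\<Delta>\<in>group_tuples G 0. slant_sum z \<Delta>)"
      using z_unit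
      by (auto simp: cohomology_unit_def cohomology_class_eq coboundaries_def slant
          cochain_group_def one_invariant_functions cong: restrict_cong)
    ultimately show ?thesis by (metis restrict_apply')
  qed
  obtain c where C_eq: "C = cohomology_class G k c"
    and c_act: "\<And>g \<Delta>. g \<in> carrier G \<Longrightarrow> \<Delta> \<in> group_tuples G k \<Longrightarrow> c (map ((\<otimes>) g) \<Delta>) = c \<Delta>"
    and c_cocycle: "\<And>\<Delta>. \<Delta> \<in> group_tuples G (Suc k) \<Longrightarrow> codiff c \<Delta> = 0"
    using group_cohomology_cases [OF C] by metis
  let ?w = "cap z c k" and ?h = "cone_homotopy (transfer z) c"
  let ?W = "(\<lambda>y. \<lambda>\<sigma>\<in>splx (int n - int k). boundary K (int n - int k + 1) y \<sigma> + ?w \<sigma>) `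
        carrier (chain_group G K \<psi> (int n - int k + 1))"
  have "?w \<in> carrier (chain_group G K \<psi> (int n - int k))"
    using chain_act [OF z(1)] c_act
    by (auto simp: chain_group_def carrier_invariant_functions group_tuples_iff intro!: cap_act)
      (simp add: cap_def)
  moreover have "boundary K (int n - int k) ?w \<tau> = 0" if "\<tau> \<in> splx (int n - int k - 1)" for \<tau>
    using z(2) c_cocycle that by (intro boundary_cap) (auto simp: group_tuples_iff)
  ultimately have "?W \<in> carrier (equivariant_homology G K \<psi> (int n - int k))"
    unfolding equivariant_homology_eq by blast
  moreover have "C = alpha_cap G n K \<alpha> \<omega> k ?W"
    unfolding alpha_cap_coset C_eq
  \<comment> \<open>The coboundary that relates the two cocycles is that of the cone homotopy
    applied to \<open>c\<close>.\<close>
  proof (rule sym, rule cohomology_class_cong)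
    show "(\<lambda>\<Delta>\<in>group_tuples G k. codiff ?h \<Delta>) \<in> coboundaries G k"
    proof (rule codiff_in_coboundaries)
      fix g \<Delta> assume "g \<in> carrier G" "set \<Delta> \<subseteq> carrier G" "length \<Delta> = k"
      then show "?h (map ((\<otimes>) g) \<Delta>) = ?h \<Delta>"
        using chain_act [OF z(1)] c_act
        by (intro cone_homotopy_transfer_act) (auto simp: group_tuples_iff)
    qed simp
    fix \<Delta> assume \<Delta>: "\<Delta> \<in> group_tuples G k"
    then have "slant_sum ?w \<Delta> = c \<Delta> + codiff ?h \<Delta>"
      using transfer_homotopic_id [OF z(2) z1, of \<Delta> c] c_cocycle
      by (simp add: slant_sum_cap group_tuples_iff)
    then show "slant G n K \<alpha> \<omega> k ?w \<Delta> = (\<lambda>\<Delta>\<in>group_tuples G k. codiff ?h \<Delta>) \<Delta> + c \<Delta>"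
      using \<Delta> by (simp add: slant)
  qed
  ultimately show ?thesis by blast
qed

end

end

section \<open>Affine simplices in the realization\<close>

lemma affine_simplex_eq: "affine_simplex ws t v = (\<Sum>j<length ws. if ws ! j = v then t j else 0)"
  by (simp add: affine_simplex_def sum.If_cases lessThan_def Collect_conj_eq)

lemma sum_affine_simplex:
  assumes "finite V" "set ws \<subseteq> V"
  shows "(\<Sum>v\<in>V. affine_simplex ws t v * F v) = (\<Sum>j<length ws. t j * F (ws ! j))"
proof -
  have "(\<Sum>v\<in>V. affine_simplex ws t v * F v) =
      (\<Sum>j<length ws. \<Sum>v\<in>V. if ws ! j = v then t j * F v else 0)"
    unfolding affine_simplex_eq sum_distrib_right
    by (subst sum.swap) (intro sum.cong refl, simp)
  also have "\<dots> = (\<Sum>j<length ws. t j * F (ws ! j))"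
    using assms by (intro sum.cong) (auto simp: subset_iff)
  finally show ?thesis .
qed

text \<open>Weights at positions with the same entry add up, and \<open>alpha_bar\<close> is linear
  in the weights; so the sum over group elements may be taken over positions, repetitions
  included.\<close>

lemma alpha_bar_affine_simplex:
  "alpha_bar \<alpha> (affine_simplex ws t) x = (\<lambda>i. \<Sum>j<length ws. t j * \<alpha> (ws ! j) x i)"
proof
  fix i
  have "affine_simplex ws t g = 0" if "g \<notin> set ws" for g
    using that by (auto simp: affine_simplex_eq intro!: sum.neutral)
  then have "alpha_bar \<alpha> (affine_simplex ws t) x i = (\<Sum>g\<in>set ws. affine_simplex ws t g * \<alpha> g x i)"
    unfolding alpha_bar_def by (intro sum.mono_neutral_left) auto
  then show "alpha_bar \<alpha> (affine_simplex ws t) x i = (\<Sum>j<length ws. t j * \<alpha> (ws ! j) x i)"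
    using sum_affine_simplex [of "set ws" ws t "\<lambda>g. \<alpha> g x i"] by simp
qed

lemma affine_simplex_in_closed_simplex:
  assumes "t \<in> standard_simplex m" "length ws = Suc m"
  shows "affine_simplex ws t \<in> closed_simplex (set ws)"
proof -
  have "(\<Sum>v\<in>set ws. affine_simplex ws t v) = 1"
    using sum_affine_simplex [of "set ws" ws t "\<lambda>_. 1"] assms
    by (simp add: standard_simplex_def lessThan_Suc_atMost)
  moreover have "0 \<le> affine_simplex ws t v" for v
    using assms(1) unfolding affine_simplex_def standard_simplex_def by (intro sum_nonneg) auto
  moreover have "affine_simplex ws t v = 0" if "v \<notin> set ws" for v
    using that unfolding affine_simplex_def by (intro sum.neutral) auto
  ultimately show ?thesis by (simp add: closed_simplex_def)
qed

lemma sum_simplical_face: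
  fixes t :: "nat \<Rightarrow> real"
  assumes "i \<le> m"
  shows "(\<Sum>j<Suc m. simplical_face i t j * a j) = (\<Sum>j<m. t j * a (if j < i then j else Suc j))"
proof -
  let ?s = "\<lambda>j. if j < i then j else Suc j"
  have im: "{..<Suc m} - {i} = ?s ` {..<m}"
  proof (intro equalityI subsetI)
    fix j assume "j \<in> {..<Suc m} - {i}"
    then show "j \<in> ?s ` {..<m}"
      using assms by (intro image_eqI [of _ _ "if j < i then j else j - 1"]) auto
  qed auto
  have inj: "inj_on ?s {..<m}" by (auto simp: inj_on_def split: if_splits)
  have "(\<Sum>j<Suc m. simplical_face i t j * a j) =
      (\<Sum>j\<in>{..<Suc m} - {i}. simplical_face i t j * a j)"
    by (rule sum.mono_neutral_right) (auto simp: simplical_face_def)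
  also have "\<dots> = (\<Sum>j<m. simplical_face i t (?s j) * a (?s j))"
    unfolding im sum.reindex [OF inj] o_def ..
  also have "\<dots> = (\<Sum>j<m. t j * a (?s j))"
    by (rule sum.cong) (simp_all add: simplical_face_def)
  finally show ?thesis .
qed

lemma affine_simplex_face:
  assumes "i < length ws"
  shows "affine_simplex ws (simplical_face i t) = affine_simplex (omit i ws) t"
proof
  fix v
  obtain m where m: "length ws = Suc m" using assms by (cases ws) auto
  have "affine_simplex ws (simplical_face i t) v =
      (\<Sum>j<Suc m. simplical_face i t j * (if ws ! j = v then 1 else 0))"
    unfolding affine_simplex_eq m by (intro sum.cong) auto
  also have "\<dots> = (\<Sum>j<m. t j * (if ws ! (if j < i then j else Suc j) = v then 1 else 0))"
    using assms m by (intro sum_simplical_face) auto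
  also have "\<dots> = affine_simplex (omit i ws) t v"
    unfolding affine_simplex_eq using assms m
    by (intro sum.cong) (auto simp: length_omit nth_omit)
  finally show "affine_simplex ws (simplical_face i t) v = affine_simplex (omit i ws) t v" .
qed

lemma affine_simplex_act:
  fixes G (structure)
  assumes "group_action G (\<Union>K) \<psi>" "g \<in> carrier G" "set ws \<subseteq> \<Union>K"
  shows "realization_act G K \<psi> g (affine_simplex ws t) = affine_simplex (map (\<psi> g) ws) t"
proof
  interpret group_action G "\<Union>K" \<psi> by (rule assms)
  interpret group G by (rule group_hom.axioms(1) [OF group_hom])
  fix v
  have wsK: "ws ! j \<in> \<Union>K" if "j < length ws" for j
    using that assms(3) nth_mem by blast
  show "realization_act G K \<psi> g (affine_simplex ws t) v = affine_simplex (map (\<psi> g) ws) t v"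
  proof (cases "v \<in> \<Union>K")
    case True
    have "ws ! j = \<psi> (inv g) v \<longleftrightarrow> \<psi> g (ws ! j) = v" if "j < length ws" for j
      using orbit_sym_aux [of g "ws ! j"] orbit_sym_aux [of "inv g" v] wsK [OF that] True assms(2)
      by auto
    then show ?thesis
      using True unfolding realization_act_def affine_simplex_eq by (auto intro!: sum.cong)
  next
    case False
    have "\<psi> g (ws ! j) \<noteq> v" if "j < length ws" for j
      using element_image [OF assms(2) wsK [OF that] refl] False by auto
    then show ?thesis
      using False unfolding realization_act_def affine_simplex_eq by (auto intro!: sum.neutral)
  qed
qed

lemma topspace_realization: "topspace (realization K) = (\<Union>s\<in>K. closed_simplex s)"
proof
  show "topspace (realization K) \<subseteq> (\<Union>s\<in>K. closed_simplex s)"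
    using openin_realization [of K "topspace (realization K)"] openin_topspace by blast
  have "(\<Union>s\<in>K. closed_simplex s) \<inter> closed_simplex s = closed_simplex s" if "s \<in> K" for s
    using that by blast
  moreover have "openin (subtopology (powertop_real UNIV) (closed_simplex s)) (closed_simplex s)" for s
    using openin_topspace [of "subtopology (powertop_real UNIV) (closed_simplex s)"] by simp
  ultimately have "openin (realization K) (\<Union>s\<in>K. closed_simplex s)"
    unfolding openin_realization by (metis subset_refl)
  then show "(\<Union>s\<in>K. closed_simplex s) \<subseteq> topspace (realization K)"
    by (rule openin_subset)
qed

text \<open>The map factors through one closed simplex with the product topology, whose inclusion is
  continuous by the definition of the weak topology.\<close>

lemma continuous_map_affine_simplex:
  assumes "set ws \<in> K" "length ws = Suc m"
  shows "continuous_map (subtopology (powertop_real UNIV) (standard_simplex m)) (realization K)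
           (affine_simplex ws)"
proof -
  let ?X = "subtopology (powertop_real UNIV) (standard_simplex m)"
  let ?Y = "subtopology (powertop_real UNIV) (closed_simplex (set ws))"
  have "continuous_map ?X euclideanreal (\<lambda>t. t j)" for j
    by (intro continuous_map_from_subtopology continuous_map_product_projection) auto
  then have "continuous_map ?X euclideanreal (\<lambda>t. affine_simplex ws t v)" for v
    unfolding affine_simplex_def by (intro continuous_map_sum) auto
  then have 1: "continuous_map ?X ?Y (affine_simplex ws)"
    using affine_simplex_in_closed_simplex [OF _ assms(2)]
    by (auto simp: continuous_map_in_subtopology continuous_map_componentwise_UNIV)
  have 2: "continuous_map ?Y (realization K) (\<lambda>x. x)"
    unfolding continuous_map_def
  proof (intro conjI allI impI)
    have "closed_simplex (set ws) \<subseteq> topspace (realization K)"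
      unfolding topspace_realization using assms(1) by (rule UN_upper)
    then show "(\<lambda>x. x) \<in> topspace ?Y \<rightarrow> topspace (realization K)"
      by (simp add: Pi_iff subset_iff)
  next
    fix U assume "openin (realization K) U"
    then have "openin ?Y (U \<inter> closed_simplex (set ws))"
      using assms(1) by (auto simp: openin_realization)
    moreover have "{x \<in> topspace ?Y. x \<in> U} = U \<inter> closed_simplex (set ws)" by auto
    ultimately show "openin ?Y {x \<in> topspace ?Y. x \<in> U}" by simp
  qed
  show ?thesis using continuous_map_compose [OF 1 2] unfolding o_def .
qed

text \<open>The open stars of the vertices cover the realization, and by local finiteness each of them
  meets only finitely many closed simplices.\<close>

lemma finite_simplices_meeting_compact:
  assumes K: "locally_finite_complex K" and C: "compactin (realization K) C"
  shows "finite {s \<in> K. closed_simplex s \<inter> C \<noteq> {}}"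
proof -
  define star where "star v = {x \<in> topspace (realization K). x v > 0}" for v
  have "openin (realization K) (star v)" for v
    unfolding openin_realization
  proof (intro conjI ballI)
    show "star v \<subseteq> (\<Union>s\<in>K. closed_simplex s)"
      by (auto simp: star_def topspace_realization)
    fix s assume "s \<in> K"
    let ?Y = "subtopology (powertop_real UNIV) (closed_simplex s)"
    have "continuous_map ?Y euclideanreal (\<lambda>x. x v)"
      by (intro continuous_map_from_subtopology continuous_map_product_projection) auto
    then have "openin ?Y {x \<in> topspace ?Y. x v \<in> {0<..}}"
      by (rule openin_continuous_map_preimage) auto
    moreover have "{x \<in> topspace ?Y. x v \<in> {0<..}} = star v \<inter> closed_simplex s"
      using \<open>s \<in> K\<close> by (auto simp: star_def topspace_realization)
    ultimately show "openin ?Y (star v \<inter> closed_simplex s)" by simp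
  qed
  moreover have "C \<subseteq> \<Union>(star ` \<Union>K)"
  proof
    fix x assume "x \<in> C"
    then have x: "x \<in> topspace (realization K)"
      using compactin_subset_topspace [OF C] by blast
    then obtain s where s: "s \<in> K" "x \<in> closed_simplex s" by (auto simp: topspace_realization)
    then have "sum x s = 1" by (simp add: closed_simplex_def)
    then obtain v where "v \<in> s" "x v \<noteq> 0"
      by (metis sum.neutral zero_neq_one)
    then show "x \<in> \<Union>(star ` \<Union>K)"
      using s x by (auto simp: star_def closed_simplex_def less_le)
  qed
  ultimately obtain \<F> where "finite \<F>" "\<F> \<subseteq> star ` \<Union>K" "C \<subseteq> \<Union>\<F>"
    using C unfolding compactin_def by (metis (no_types, lifting) imageE)
  then obtain V where V: "finite V" "V \<subseteq> \<Union>K" "C \<subseteq> \<Union>(star ` V)"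
    by (metis finite_subset_image)
  have "{s \<in> K. closed_simplex s \<inter> C \<noteq> {}} \<subseteq> (\<Union>v\<in>V. {s \<in> K. v \<in> s})"
  proof
    fix s assume s: "s \<in> {s \<in> K. closed_simplex s \<inter> C \<noteq> {}}"
    then obtain x where x: "x \<in> closed_simplex s" "x \<in> C" by blast
    then obtain v where v: "v \<in> V" "x v > 0" using V(3) by (auto simp: star_def)
    then have "v \<in> s" using x(1) unfolding closed_simplex_def by (metis (mono_tags, lifting) less_irrefl mem_Collect_eq)
    then show "s \<in> (\<Union>v\<in>V. {s \<in> K. v \<in> s})" using s v by blast
  qed
  moreover have "finite (\<Union>v\<in>V. {s \<in> K. v \<in> s})"
    using V(1,2) K by (auto simp: locally_finite_complex_def)
  ultimately show ?thesis by (rule finite_subset)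
qed

text \<open>A vertex is a point of the realization, so the action is free on vertices. Hence exactly
  one group element carries the chosen representative of an orbit to a given vertex, and this
  uniqueness is equivariance.\<close>

lemma equivariant_vertex_map:
  fixes G (structure)
  assumes "group G" and K: "simplicial_complex K" and free: "free_simplicial_action G K \<psi>"
  obtains f where "\<And>v. v \<in> \<Union>K \<Longrightarrow> f v \<in> carrier G"
    "\<And>g v. g \<in> carrier G \<Longrightarrow> v \<in> \<Union>K \<Longrightarrow> f (\<psi> g v) = g \<otimes> f v"
proof -
  interpret group G by (rule assms)
  have act: "group_action G (\<Union>K) \<psi>" using free by (simp add: free_simplicial_action_def)
  interpret group_action G "\<Union>K" \<psi> by (rule act)
  have stab: "g = \<one>" if g: "g \<in> carrier G" and v: "v \<in> \<Union>K" and "\<psi> g v = v" for g v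
  proof -
    let ?x = "affine_simplex [v] (\<lambda>j. if j = 0 then 1 else 0)"
    obtain s where s: "s \<in> K" "{v} \<subseteq> s" using v by blast
    have "t \<in> K" if "t \<subseteq> s" "t \<noteq> {}" for t
      using K s(1) that unfolding simplicial_complex_def by blast
    from this [OF s(2)] have "{v} \<in> K" by blast
    moreover have "?x \<in> closed_simplex (set [v])"
      by (rule affine_simplex_in_closed_simplex) (auto simp: standard_simplex_0)
    ultimately have "?x \<in> topspace (realization K)" by (auto simp: topspace_realization)
    moreover have "realization_act G K \<psi> g ?x = ?x"
      using affine_simplex_act [OF act g, of "[v]"] v \<open>\<psi> g v = v\<close> by simp
    ultimately show ?thesis using free g by (auto simp: free_simplicial_action_def)
  qed
  \<comment> \<open>Vertices are natural numbers, so the least one is a representative that depends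
    on the orbit only.\<close>
  define r where "r v = (LEAST u. u \<in> orbit G \<psi> v)" for v
  define f where "f v = (SOME g. g \<in> carrier G \<and> \<psi> g (r v) = v)" for v
  have r_orbit: "r v \<in> orbit G \<psi> v" if "v \<in> \<Union>K" for v
    unfolding r_def using orbit_refl [OF that] by (rule LeastI)
  have r_vertex: "r v \<in> \<Union>K" if v: "v \<in> \<Union>K" for v
  proof -
    obtain g where "g \<in> carrier G" "r v = \<psi> g v"
      using r_orbit [OF v] unfolding orbit_def by blast
    then show ?thesis using element_image [OF _ v, of g "r v"] by simp
  qed
  have f: "f v \<in> carrier G \<and> \<psi> (f v) (r v) = v" if "v \<in> \<Union>K" for v
    unfolding f_def
  proof (rule someI_ex)
    show "\<exists>g. g \<in> carrier G \<and> \<psi> g (r v) = v"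
    proof -
      have "v \<in> orbit G \<psi> (r v)"
        by (rule orbit_sym [OF that r_vertex [OF that] r_orbit [OF that]])
      then show ?thesis unfolding orbit_def mem_Collect_eq by (elim exE conjE) (intro exI conjI, auto)
    qed
  qed
  have f_act: "f (\<psi> g v) = g \<otimes> f v" if g: "g \<in> carrier G" and v: "v \<in> \<Union>K" for g v
  proof -
    have gv: "\<psi> g v \<in> \<Union>K" by (rule element_image [OF g v refl])
    have comp: "\<psi> h (\<psi> g v) = \<psi> (h \<otimes> g) v" if "h \<in> carrier G" for h
      using composition_rule [OF v that g] by simp
    have "orbit G \<psi> (\<psi> g v) = orbit G \<psi> v"
    proof (intro equalityI subsetI)
      fix x assume "x \<in> orbit G \<psi> (\<psi> g v)"
      then obtain h where h: "h \<in> carrier G" "x = \<psi> h (\<psi> g v)"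
        unfolding orbit_def by blast
      then have "x = \<psi> (h \<otimes> g) v" "h \<otimes> g \<in> carrier G" using comp g by auto
      then show "x \<in> orbit G \<psi> v" unfolding orbit_def by blast
    next
      fix x assume "x \<in> orbit G \<psi> v"
      then obtain h where h: "h \<in> carrier G" "x = \<psi> h v"
        unfolding orbit_def by blast
      then have "x = \<psi> (h \<otimes> inv g) (\<psi> g v)" "h \<otimes> inv g \<in> carrier G"
        using comp [of "h \<otimes> inv g"] g by (auto simp: m_assoc)
      then show "x \<in> orbit G \<psi> (\<psi> g v)" unfolding orbit_def by blast
    qed
    then have r: "r (\<psi> g v) = r v" by (simp add: r_def)
    \<comment> \<open>Both \<open>g \<otimes> f v\<close> and \<open>f (\<psi> g v)\<close> carry
      the representative to \<open>\<psi> g v\<close>; their quotient fixes a vertex.\<close>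
    let ?h = "inv (g \<otimes> f v) \<otimes> f (\<psi> g v)"
    have cl: "f v \<in> carrier G" "f (\<psi> g v) \<in> carrier G" using f [OF v] f [OF gv] by blast+
    have "\<psi> (g \<otimes> f v) (r v) = \<psi> (f (\<psi> g v)) (r v)"
      using composition_rule [OF r_vertex [OF v] g cl(1)] f [OF v] f [OF gv] r by simp
    then have "\<psi> ?h (r v) = r v"
      using composition_rule [OF r_vertex [OF v], of "inv (g \<otimes> f v)" "f (\<psi> g v)"]
        orbit_sym_aux [OF _ r_vertex [OF v] refl, of "g \<otimes> f v"] g cl by simp
    then have "?h = \<one>" by (intro stab [OF _ r_vertex [OF v]]) (use g cl in auto)
    then show ?thesis
      using g cl by (metis inv_closed inv_equality inv_inv m_closed)
  qed
  show thesis
  proof (rule that [of f])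
    show "f v \<in> carrier G" if "v \<in> \<Union>K" for v using f [OF that] by simp
  qed (rule f_act)
qed

section \<open>The cochain of a proper Lipschitz map\<close>

definition product_simplex ::
    "('g \<Rightarrow> (nat \<Rightarrow> real) \<Rightarrow> nat \<Rightarrow> real) \<Rightarrow> nat \<Rightarrow> ('g \<times> nat) list \<Rightarrow> (nat \<Rightarrow> real) \<Rightarrow> nat \<Rightarrow> real"
  where
  "product_simplex \<alpha> m p = restrict
     (\<lambda>t. alpha_bar \<alpha> (affine_simplex (map fst p) t) (affine_simplex (map snd p) t))
     (standard_simplex m)"

lemma cochain_eval_product_chain:
  "cochain_eval \<omega> (product_chain \<alpha> m \<Delta> \<sigma>) =
     frag_eval (\<lambda>p. \<omega> (product_simplex \<alpha> m p)) (staircase \<Delta> \<sigma>)"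
  by (simp add: product_chain_def cochain_eval_eq_frag_eval frag_eval_extend product_simplex_def)

lemma product_simplex_apply:
  assumes "t \<in> standard_simplex m"
  shows "product_simplex \<alpha> m p t =
    (\<lambda>i. \<Sum>j<length p. t j * \<alpha> (fst (p ! j)) (affine_simplex (map snd p) t) i)"
  using assms by (auto simp: product_simplex_def alpha_bar_affine_simplex intro!: sum.cong)

text \<open>No affinity of \<open>\<alpha>\<close> along P is involved: both coordinates of the path
  are precomposed with the same face map.\<close>

lemma singular_face_product_simplex:
  assumes "length p = Suc (Suc m)" "i \<le> Suc m"
  shows "singular_face (Suc m) i (product_simplex \<alpha> (Suc m) p) = product_simplex \<alpha> m (omit i p)"
proof
  fix t
  show "singular_face (Suc m) i (product_simplex \<alpha> (Suc m) p) t = product_simplex \<alpha> m (omit i p) t"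
  proof (cases "t \<in> standard_simplex m")
    case True
    then have "simplical_face i t \<in> standard_simplex (Suc m)"
      using simplical_face_in_standard_simplex [of "Suc m" i t] assms(2) by simp
    then show ?thesis
      using True assms
      by (simp add: singular_face_def product_simplex_def affine_simplex_face omit_map)
  qed (simp add: singular_face_def product_simplex_def)
qed

lemma Rn_dist_component: "i < n \<Longrightarrow> \<bar>x i - y i\<bar> \<le> Rn_dist n x y"
  unfolding Rn_dist_def using member_le_L2_set [of "{..<n}" i "\<lambda>i. \<bar>x i - y i\<bar>"]
  by (simp add: L2_set_def)

text \<open>A box replaces the ball: it is a product of compact sets, and coordinatewise bounds
  place a point in it. The factors \<open>{0}\<close> match the vanishing coordinates of
  \<open>Euclidean_space\<close>.\<close>

lemma compactin_box:
  "compactin (Euclidean_space n) (PiE UNIV (\<lambda>i. if i < n then {c i - \<rho>..c i + \<rho>} else {0}))"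
proof -
  let ?B = "PiE UNIV (\<lambda>i. if i < n then {c i - \<rho>..c i + \<rho>} else {0})"
  have "compactin (powertop_real UNIV) ?B"
    by (subst compactin_PiE) auto
  moreover have "x i = 0" if "x \<in> ?B" "n \<le> i" for x i
    using PiE_mem [OF that(1), of i] that(2) by simp
  then have "?B \<subseteq> {x. \<forall>i\<ge>n. x i = 0}" by blast
  ultimately show ?thesis
    unfolding Euclidean_space_def compactin_subtopology by (rule conjI)
qed

locale lipschitz_cochain = group G for G (structure) +
  fixes S :: "'a set" and n K and \<psi> :: "'a \<Rightarrow> nat \<Rightarrow> nat" and \<alpha> \<omega>
  assumes data: "proper_lipschitz_data G S n K \<psi> \<alpha>" and gen: "ball_supported_generator n \<omega>"
begin

lemma complex: "simplicial_complex K" "locally_finite_complex K" "free_simplicial_action G K \<psi>"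
  using data by (auto simp: proper_lipschitz_data_def)

lemma act: "group_action G (\<Union>K) \<psi>"
  using complex(3) by (simp add: free_simplicial_action_def)

lemma alpha_equivariant:
  "g \<in> carrier G \<Longrightarrow> h \<in> carrier G \<Longrightarrow> x \<in> topspace (realization K) \<Longrightarrow>
     \<alpha> (g \<otimes> h) (realization_act G K \<psi> g x) = \<alpha> h x"
  using data by (simp add: proper_lipschitz_data_def)

lemma alpha_lipschitz:
  "x \<in> topspace (realization K) \<Longrightarrow> g \<in> carrier G \<Longrightarrow> h \<in> carrier G \<Longrightarrow>
     Rn_dist n (\<alpha> g x) (\<alpha> h x) \<le> real (word_dist G S g h)"
  using data by (simp add: proper_lipschitz_data_def)

lemma alpha_proper: "g \<in> carrier G \<Longrightarrow> proper_map (realization K) (Euclidean_space n) (\<alpha> g)"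
  using data by (simp add: proper_lipschitz_data_def)

lemma alpha_continuous:
  assumes "g \<in> carrier G"
  shows "continuous_map (realization K) (Euclidean_space n) (\<alpha> g)"
proof -
  have 1: "continuous_map (realization K) (prod_topology (discrete_topology (carrier G)) (realization K))
      (\<lambda>x. (g, x))"
    using assms by (simp add: continuous_map_paired)
  have 2: "continuous_map (prod_topology (discrete_topology (carrier G)) (realization K))
       (Euclidean_space n) (\<lambda>(g, x). \<alpha> g x)"
    using data by (simp add: proper_lipschitz_data_def)
  show ?thesis
    using continuous_map_compose [OF 1 2] unfolding o_def prod.case .
qed

lemma affine_simplex_in_realization:
  assumes "t \<in> standard_simplex m" "length ws = Suc m" "set ws \<in> K"
  shows "affine_simplex ws t \<in> topspace (realization K)"
  using affine_simplex_in_closed_simplex [OF assms(1,2)] assms(3) by (auto simp: topspace_realization)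

lemma singular_simplex_product_simplex:
  assumes "length p = Suc m" "set (map fst p) \<subseteq> carrier G" "set (map snd p) \<in> K"
  shows "singular_simplex m (Euclidean_space n) (product_simplex \<alpha> m p)"
proof -
  let ?X = "subtopology (powertop_real UNIV) (standard_simplex m)"
  have fst_p: "fst (p ! j) \<in> carrier G" if "j < length p" for j
    using assms(2) that by (force simp: in_set_conv_nth)
  have \<alpha>: "continuous_map ?X (Euclidean_space n)
      (\<lambda>t. \<alpha> (fst (p ! j)) (affine_simplex (map snd p) t))" if "j < length p" for j
    using continuous_map_compose [OF continuous_map_affine_simplex alpha_continuous [OF fst_p [OF that]],
        of "map snd p" m] assms
    by (simp add: o_def)
  then have \<alpha>_i: "continuous_map ?X euclideanreal
      (\<lambda>t. \<alpha> (fst (p ! j)) (affine_simplex (map snd p) t) i)" if "j < length p" for j i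
    using that
    by (auto simp: Euclidean_space_def continuous_map_in_subtopology continuous_map_componentwise_UNIV)
  have zero: "\<alpha> (fst (p ! j)) (affine_simplex (map snd p) t) i = 0"
    if "j < length p" "t \<in> standard_simplex m" "n \<le> i" for j i t
    using \<alpha> [OF that(1)] that(2,3)
    by (auto simp: continuous_map_def topspace_Euclidean_space Pi_iff)
  have "continuous_map ?X euclideanreal (\<lambda>t. t j)" for j
    by (intro continuous_map_from_subtopology continuous_map_product_projection) auto
  then have "continuous_map ?X euclideanreal
      (\<lambda>t. \<Sum>j<length p. t j * \<alpha> (fst (p ! j)) (affine_simplex (map snd p) t) i)" for i
    using \<alpha>_i by (intro continuous_map_sum continuous_map_real_mult) auto
  then have "continuous_map ?X (Euclidean_space n)
      (\<lambda>t i. \<Sum>j<length p. t j * \<alpha> (fst (p ! j)) (affine_simplex (map snd p) t) i)"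
    unfolding Euclidean_space_def
    by (auto simp: continuous_map_in_subtopology continuous_map_componentwise_UNIV zero
        intro!: sum.neutral)
  then have "continuous_map ?X (Euclidean_space n) (product_simplex \<alpha> m p)"
    by (rule continuous_map_eq) (simp add: product_simplex_apply)
  then show ?thesis
    by (simp add: singular_simplex_def product_simplex_def)
qed

lemma product_simplex_act:
  assumes g: "g \<in> carrier G" and p: "length p = Suc m" "set (map fst p) \<subseteq> carrier G" "set (map snd p) \<in> K"
  shows "product_simplex \<alpha> m (map (map_prod ((\<otimes>) g) (\<psi> g)) p) = product_simplex \<alpha> m p"
proof
  fix t
  let ?p = "map (map_prod ((\<otimes>) g) (\<psi> g)) p"
  show "product_simplex \<alpha> m ?p t = product_simplex \<alpha> m p t"
  proof (cases "t \<in> standard_simplex m")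
    case True
    let ?x = "affine_simplex (map snd p) t"
    have x: "?x \<in> topspace (realization K)"
      using affine_simplex_in_realization True p by simp
    have "map snd ?p = map (\<psi> g) (map snd p)" by simp
    moreover have "set (map snd p) \<subseteq> \<Union>K" using p(3) by (rule Union_upper)
    ultimately have act_x: "affine_simplex (map snd ?p) t = realization_act G K \<psi> g ?x"
      using affine_simplex_act [OF act g] by metis
    have "\<alpha> (fst (?p ! j)) (affine_simplex (map snd ?p) t) = \<alpha> (fst (p ! j)) ?x"
      if "j < length p" for j
    proof -
      have "fst (p ! j) \<in> carrier G" using p(2) that by (force simp: in_set_conv_nth)
      then show ?thesis
        unfolding act_x using alpha_equivariant [OF g _ x] that by simp
    qed
    then show ?thesis
      unfolding product_simplex_apply [OF True] length_map by (intro ext sum.cong) auto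
  qed (simp add: product_simplex_def)
qed

text \<open>The cocycle condition of \<open>\<omega>\<close> on a single singular simplex of
  dimension \<open>n + 1\<close>, whose singular faces come from omitting entries of
  \<open>p\<close>.\<close>

lemma codiff_product_simplex:
  assumes "length p = Suc (Suc n)" "set (map fst p) \<subseteq> carrier G" "set (map snd p) \<in> K"
  shows "codiff (\<lambda>p. \<omega> (product_simplex \<alpha> n p)) p = 0"
proof -
  let ?f = "product_simplex \<alpha> (Suc n) p"
  have "singular_cocycle n (Euclidean_space n) \<omega>"
    using gen by (simp add: ball_supported_generator_def)
  moreover have "singular_chain (Suc n) (Euclidean_space n) (frag_of ?f)"
    unfolding singular_chain_of by (rule singular_simplex_product_simplex) (use assms in auto)
  ultimately have "cochain_eval \<omega> (chain_boundary (Suc n) (frag_of ?f)) = 0"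
    unfolding singular_cocycle_def by blast
  moreover have "cochain_eval \<omega> (chain_boundary (Suc n) (frag_of ?f)) =
      (\<Sum>k\<le>Suc n. (-1) ^ k * \<omega> (singular_face (Suc n) k ?f))"
    unfolding cochain_eval_eq_frag_eval chain_boundary_of by (simp add: frag_eval_sum)
  ultimately show ?thesis
    unfolding codiff_def assms(1) lessThan_Suc_atMost
    using singular_face_product_simplex [OF assms(1)] by simp
qed

text \<open>The bound on the total length makes the path nonempty, so that its vertices do span a
  simplex.\<close>

lemma staircase_vertices:
  assumes "p \<in> Poly_Mapping.keys (staircase \<Delta> \<sigma>)" "set \<Delta> \<subseteq> carrier G" "set \<sigma> \<in> K" "\<Delta> \<noteq> []"
    "length \<Delta> + length \<sigma> \<ge> 2"
  shows "set (map fst p) \<subseteq> carrier G" "set (map snd p) \<in> K"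
proof -
  note p = keys_staircase [OF assms(1)]
  show "set (map fst p) \<subseteq> carrier G" using p(2) assms(2) by (rule subset_trans)
  have "set (map snd p) \<noteq> {}" using p(1) assms(5) by auto
  then show "set (map snd p) \<in> K"
    using p(3) assms(3) complex(1) unfolding simplicial_complex_def by blast
qed

text \<open>A point of the product simplex is a convex combination of values
  \<open>\<alpha> g x\<close> at one common \<open>x\<close>; each of them is within
  \<open>R\<close> of \<open>\<alpha> h x\<close> in every coordinate.\<close>

lemma product_simplex_near:
  assumes h: "h \<in> carrier G"
    and R: "\<And>g. g \<in> set (map fst p) \<Longrightarrow> real (word_dist G S h g) \<le> R"
    and p: "length p = Suc m" "set (map fst p) \<subseteq> carrier G" "set (map snd p) \<in> K"
    and t: "t \<in> standard_simplex m" and i: "i < n"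
  shows "\<bar>\<alpha> h (affine_simplex (map snd p) t) i - product_simplex \<alpha> m p t i\<bar> \<le> R"
proof -
  let ?x = "affine_simplex (map snd p) t"
  have x: "?x \<in> topspace (realization K)"
    using affine_simplex_in_realization t p by simp
  have t0: "0 \<le> t j" for j using t by (simp add: standard_simplex_def)
  have t1: "(\<Sum>j<length p. t j) = 1"
    using t p(1) by (simp add: standard_simplex_def lessThan_Suc_atMost)
  have "\<bar>\<alpha> h ?x i - \<alpha> (fst (p ! j)) ?x i\<bar> \<le> R" if "j < length p" for j
  proof -
    have "fst (p ! j) \<in> set (map fst p)" using that by simp
    moreover from this have "fst (p ! j) \<in> carrier G" using p(2) by blast
    ultimately show ?thesis
      using R Rn_dist_component [OF i, of "\<alpha> h ?x" "\<alpha> (fst (p ! j)) ?x"]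
        alpha_lipschitz [OF x h, of "fst (p ! j)"] by fastforce
  qed
  then have "\<bar>\<Sum>j<length p. t j * (\<alpha> h ?x i - \<alpha> (fst (p ! j)) ?x i)\<bar> \<le> (\<Sum>j<length p. t j * R)"
    using t0 by (intro order_trans [OF sum_abs] sum_mono) (simp add: abs_mult mult_left_mono)
  moreover have "(\<Sum>j<length p. t j * (\<alpha> h ?x i - \<alpha> (fst (p ! j)) ?x i)) =
      \<alpha> h ?x i - product_simplex \<alpha> m p t i"
    using t1 by (simp add: product_simplex_apply [OF t] right_diff_distrib sum_subtractf
        flip: sum_distrib_right)
  ultimately show ?thesis using t1 by (simp flip: sum_distrib_right)
qed

text \<open>By the Lipschitz condition all simplices of the product of \<open>\<Delta>\<close> and \<open>\<sigma>\<close> stay within a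
  distance of \<open>\<alpha> (hd \<Delta>)\<close> that depends on \<open>\<Delta>\<close> only, so that they can meet the support of \<open>\<omega>\<close>
  only if \<open>\<sigma>\<close> meets a fixed compact set.\<close>

lemma finite_support:
  assumes \<Delta>: "set \<Delta> \<subseteq> carrier G" and m: "int (length \<Delta>) + m = int n + 1"
  shows "finite {\<sigma> \<in> ordered_simplices K m. cochain_eval \<omega> (product_chain \<alpha> n \<Delta> \<sigma>) \<noteq> 0}"
proof (cases "\<Delta> = []")
  case False
  define h where "h = hd \<Delta>"
  have h: "h \<in> carrier G" using False \<Delta> by (auto simp: h_def)
  obtain c r where supp: "supported_in n (Euclidean_space n)
      {x \<in> topspace (Euclidean_space n). Rn_dist n c x \<le> r} \<omega>"
    using gen unfolding ball_supported_generator_def by blast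
  \<comment> \<open>A bound for all distances from \<open>h\<close> that depends on
    \<open>\<Delta>\<close> only; the sum of nonnegative terms dominates each of them.\<close>
  define R where "R = (\<Sum>g\<in>set \<Delta>. real (word_dist G S h g))"
  have R: "real (word_dist G S h g) \<le> R" if "g \<in> set \<Delta>" for g
    unfolding R_def using that by (intro member_le_sum) auto
  define B where "B = PiE UNIV (\<lambda>i. if i < n then {c i - (r + R)..c i + (r + R)} else {0})"
  define Q where "Q = {x \<in> topspace (realization K). \<alpha> h x \<in> B}"
  have "compactin (realization K) Q"
    unfolding Q_def B_def using compactin_proper_map_preimage [OF alpha_proper [OF h] compactin_box] .
  then have fin: "finite {s \<in> K. closed_simplex s \<inter> Q \<noteq> {}}"
    by (rule finite_simplices_meeting_compact [OF complex(2)])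
  have meets: "closed_simplex (set \<sigma>) \<inter> Q \<noteq> {}"
    if \<sigma>: "\<sigma> \<in> ordered_simplices K m" and ne: "cochain_eval \<omega> (product_chain \<alpha> n \<Delta> \<sigma>) \<noteq> 0" for \<sigma>
  proof -
    obtain p where p: "p \<in> Poly_Mapping.keys (staircase \<Delta> \<sigma>)" "\<omega> (product_simplex \<alpha> n p) \<noteq> 0"
      using ne unfolding cochain_eval_product_chain by (meson frag_eval_eq_0)
    have len: "length \<Delta> + length \<sigma> = n + 2" and \<sigma>K: "set \<sigma> \<in> K"
      using \<sigma> m by (auto simp: ordered_simplices_def)
    have lp: "length p = Suc n" using keys_staircase(1) [OF p(1)] len by simp
    note vp = staircase_vertices [OF p(1) \<Delta> \<sigma>K False]
    have pG: "set (map fst p) \<subseteq> carrier G" and pK: "set (map snd p) \<in> K"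
      using vp len by auto
    let ?C = "{x \<in> topspace (Euclidean_space n). Rn_dist n c x \<le> r}"
    \<comment> \<open>A simplex on which \<open>\<omega>\<close> is nonzero cannot avoid the
      supporting ball; \<open>t\<close> is a parameter where it meets the ball.\<close>
    have "\<not> singular_simplex n (subtopology (Euclidean_space n) (- ?C)) (product_simplex \<alpha> n p)"
      using supp p(2) unfolding supported_in_def by blast
    then obtain t where t: "t \<in> standard_simplex n" "product_simplex \<alpha> n p t \<in> ?C"
      using singular_simplex_product_simplex [OF lp pG pK]
      unfolding singular_simplex_subtopology by blast
    let ?x = "affine_simplex (map snd p) t"
    have "?x \<in> closed_simplex (set (map snd p))"
      by (rule affine_simplex_in_closed_simplex [OF t(1)]) (simp add: lp)
    moreover have "closed_simplex s \<subseteq> closed_simplex s'" if "s \<subseteq> s'" "finite s'" for s s'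
      using that sum.mono_neutral_left [OF that(2,1)]
      unfolding closed_simplex_def by (auto simp: subset_iff)
    ultimately have x\<sigma>: "?x \<in> closed_simplex (set \<sigma>)"
      using keys_staircase(3) [OF p(1)] by blast
    have x: "?x \<in> topspace (realization K)"
      using affine_simplex_in_realization [OF t(1) _ pK] lp by simp
    have "\<alpha> h ?x i \<in> {c i - (r + R)..c i + (r + R)}" if "i < n" for i
    proof -
      have "\<bar>\<alpha> h ?x i - product_simplex \<alpha> n p t i\<bar> \<le> R"
        using keys_staircase(2) [OF p(1)] R
        by (intro product_simplex_near [OF h _ lp pG pK t(1) that]) blast
      moreover have "\<bar>c i - product_simplex \<alpha> n p t i\<bar> \<le> r"
        using Rn_dist_component [OF that] t(2) order_trans by blast
      ultimately show ?thesis by (simp add: abs_le_iff)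
    qed
    moreover have "\<alpha> h ?x i = 0" if "\<not> i < n" for i
      using alpha_continuous [OF h] x that
      by (auto simp: continuous_map_def topspace_Euclidean_space Pi_iff)
    ultimately have "\<alpha> h ?x \<in> B" unfolding B_def by auto
    then show ?thesis using x x\<sigma> unfolding Q_def by blast
  qed
  \<comment> \<open>Finitely many simplices meet \<open>Q\<close>, so the entries of all these
    \<open>\<sigma>\<close> come from one finite set, and their length is fixed.\<close>
  let ?F = "\<Union>{s \<in> K. closed_simplex s \<inter> Q \<noteq> {}}"
  have "finite ?F"
    using fin complex(1) by (auto simp: simplicial_complex_def)
  from finite_lists_length_eq [OF this, of "nat (m + 1)"] show ?thesis
    by (rule rev_finite_subset) (use meets in \<open>auto simp: ordered_simplices_def\<close>)
qed (simp add: cochain_eval_product_chain)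

lemma alpha_cap_surjective:
  assumes "cohomology_unit G \<in> alpha_cap G n K \<alpha> \<omega> 0 ` carrier (equivariant_homology G K \<psi> (int n))"
    and "C \<in> carrier (group_cohomology G k)"
  shows "C \<in> alpha_cap G n K \<alpha> \<omega> k ` carrier (equivariant_homology G K \<psi> (int n - int k))"
proof -
  obtain f where f: "\<And>v. v \<in> \<Union>K \<Longrightarrow> f v \<in> carrier G"
    "\<And>g v. g \<in> carrier G \<Longrightarrow> v \<in> \<Union>K \<Longrightarrow> f (\<psi> g v) = g \<otimes> f v"
    by (rule equivariant_vertex_map [OF is_group complex(1,3)]) (rule that; assumption)
  let ?\<Phi> = "\<lambda>p. \<omega> (product_simplex \<alpha> n p)"
  interpret equivariant_slant G K \<psi> n "\<lambda>\<Delta> \<sigma>. cochain_eval \<omega> (product_chain \<alpha> n \<Delta> \<sigma>)" f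
  proof (intro equivariant_slant.intro equivariant_slant_axioms.intro)
    show "group G" by (rule is_group)
    show "simplicial_complex K" "locally_finite_complex K" "group_action G (\<Union>K) \<psi>"
      by (rule complex act)+
    show "\<psi> g ` s \<in> K" if "g \<in> carrier G" "s \<in> K" for g s
      using complex(3) that by (simp add: free_simplicial_action_def)
    show "cochain_eval \<omega> (product_chain \<alpha> n \<Delta> []) = 0"
      "cochain_eval \<omega> (product_chain \<alpha> n [] \<sigma>) = 0" for \<Delta> \<sigma>
      by (simp_all add: cochain_eval_product_chain)
    show "finite {\<sigma> \<in> ordered_simplices K m. cochain_eval \<omega> (product_chain \<alpha> n \<Delta> \<sigma>) \<noteq> 0}"
      if "set \<Delta> \<subseteq> carrier G" "int (length \<Delta>) + m = int n + 1" for \<Delta> m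
      by (rule finite_support [OF that])
    show "cochain_eval \<omega> (product_chain \<alpha> n (map ((\<otimes>) g) \<Delta>) (map (\<psi> g) \<sigma>)) =
        cochain_eval \<omega> (product_chain \<alpha> n \<Delta> \<sigma>)"
      if "g \<in> carrier G" "set \<Delta> \<subseteq> carrier G" "set \<sigma> \<in> K" "length \<Delta> + length \<sigma> = n + 2" for g \<Delta> \<sigma>
    proof (cases "\<Delta> = []")
      case False
      show ?thesis
        unfolding cochain_eval_product_chain frag_eval_staircase_map
      proof (rule frag_eval_cong)
        fix p assume p: "p \<in> Poly_Mapping.keys (staircase \<Delta> \<sigma>)"
        have "length p = Suc n" using keys_staircase(1) [OF p] that(4) by simp
        moreover note staircase_vertices [OF p that(2,3) False]
        ultimately show "?\<Phi> (map (map_prod ((\<otimes>) g) (\<psi> g)) p) = ?\<Phi> p"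
          using product_simplex_act [OF that(1), of p n] that(4) by simp
      qed
    qed (simp add: cochain_eval_product_chain)
    show "codiff (\<lambda>\<sigma>. cochain_eval \<omega> (product_chain \<alpha> n \<Delta> \<sigma>)) \<sigma> =
        (-1) ^ length \<Delta> * codiff (\<lambda>\<Delta>'. cochain_eval \<omega> (product_chain \<alpha> n \<Delta>' \<sigma>)) \<Delta>"
      if "set \<Delta> \<subseteq> carrier G" "set \<sigma> \<in> K" "length \<Delta> + length \<sigma> = n + 3" for \<Delta> \<sigma>
    proof (cases "\<Delta> = []")
      case False
      have "frag_eval (codiff ?\<Phi>) (staircase \<Delta> \<sigma>) = 0"
      proof (rule frag_eval_eq_0)
        fix p assume p: "p \<in> Poly_Mapping.keys (staircase \<Delta> \<sigma>)"
        have "length p = Suc (Suc n)" using keys_staircase(1) [OF p] that(3) by simp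
        moreover note staircase_vertices [OF p that(1,2) False]
        ultimately show "codiff ?\<Phi> p = 0"
          using that(3) by (intro codiff_product_simplex) auto
      qed
      \<comment> \<open>Total length \<open>n + 3\<close> is at least 3, which excludes the
        augmentation term of \<open>codiff_staircase\<close>.\<close>
      moreover have not_1: "\<not> (length \<Delta> = 1 \<and> length \<sigma> = 1)" using that(3) by auto
      ultimately have "codiff (\<lambda>\<Delta>'. cochain_eval \<omega> (product_chain \<alpha> n \<Delta>' \<sigma>)) \<Delta> =
          (-1) ^ length \<Delta> * codiff (\<lambda>\<sigma>. cochain_eval \<omega> (product_chain \<alpha> n \<Delta> \<sigma>)) \<sigma>"
        using codiff_staircase [of ?\<Phi> \<Delta> \<sigma>, unfolded if_not_P [OF not_1]]
        unfolding cochain_eval_product_chain by linarith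
      then show ?thesis by (simp flip: power_add mult.assoc)
    qed (simp add: cochain_eval_product_chain)
    show "f v \<in> carrier G" if "v \<in> \<Union>K" for v by (rule f(1) [OF that])
    show "f (\<psi> g v) = g \<otimes> f v" if "g \<in> carrier G" "v \<in> \<Union>K" for g v by (rule f(2) [OF that])
  qed
  have slant: "slant G n K \<alpha> \<omega> k z = (\<lambda>\<Delta>\<in>group_tuples G k. slant_sum z \<Delta>)" for k z
    by (auto simp: slant_def slant_sum_def group_tuples_iff Let_def)
  show ?thesis by (rule alpha_cap_surj [OF slant assms])
qed

end

theorem corollary4p9:
  fixes G :: "('g, 'a) monoid_scheme" and S :: "'g set"
    and E :: "'e topology" and B :: "'b topology"
  assumes "group G"
    and "finite S" and "S \<subseteq> carrier G" and "generate G S = carrier G"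
    and "classifying_space G E B" and "finite_CW_complex B"
    and "proper_lipschitz_class G S 0 (cohomology_unit G)"
  shows "\<forall>k. \<forall>c\<in>carrier (group_cohomology G k). proper_lipschitz_class G S k c"
proof (intro allI ballI)
  fix k c assume c: "c \<in> carrier (group_cohomology G k)"
  obtain n K \<psi> \<alpha> \<omega> where lip: "proper_lipschitz_data G S n K \<psi> \<alpha>" "ball_supported_generator n \<omega>"
    and unit: "cohomology_unit G \<in> alpha_cap G n K \<alpha> \<omega> 0 ` carrier (equivariant_homology G K \<psi> (int n))"
    using assms(7) by (auto simp: proper_lipschitz_class_def)
  interpret lipschitz_cochain G S n K \<psi> \<alpha> \<omega>
    using assms(1) lip by (simp add: lipschitz_cochain_def lipschitz_cochain_axioms_def)
  show "proper_lipschitz_class G S k c"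
    unfolding proper_lipschitz_class_def
    using lip alpha_cap_surjective [OF unit c] by (intro exI conjI)
qed

end
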